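(* There exists a constant $K$ such that for all $\beta\ge\tfrac13$, all $n\ge1$, and any faces $f,f'$ of $\Lambda_n$ (with free or zero boundary conditions), $$\mathbb E^{Coul}_\beta\Big[e^{2i\pi(\Delta^{-1}q(f)-\Delta^{-1}q(f'))}\Big]\ \le\ K\exp\Big(-\tfrac12\,\frac{M(\beta)}{2(2\pi)^2\beta}\,\big\langle \mathbf 1_f-\mathbf 1_{f'},\,(-\Delta)^{-1}(\mathbf 1_f-\mathbf 1_{f'})\big\rangle\Big).$$
   Context: Graphs. $\Lambda_n$ is one of two graphs embedded in the sphere. Free boundary conditions: $[-n,n]^2\cap\mathbb Z^2$ with nearest-neighbour edges; the marked face $f_0$ is the face containing the point at infinity. Zero (Dirichlet) boundary conditions: $([-n,n]^2\cap\mathbb Z^2)\cup\{\infty\}$ with nearest-neighbour edges and the vertices of $\partial[-n,n]^2$ connected to $\infty$ so that the graph is the planar dual of a square-grid box (one edge to $\infty$ for each non-corner boundary vertex, two parallel edges for each corner); the marked face $f_0$ is a face in the middle of the graph. $E,F$ are the sets of edges and faces. 2-forms. Orienting all faces coherently, a 2-form is a function $g:F\to\mathbb R$ with $g(f_0)=0$; $\langle g_1,g_2\rangle=\sum_{f\in F}g_1(f)g_2(f)$. On 2-forms, $\Delta$ is the (negative definite, invertible) graph Laplacian of the dual graph with value $0$ imposed at $f_0$: $\langle g,(-\Delta)g\rangle=\sum_{e\in E}(g(f)-g(f'))^2$, where $f,f'$ are the two faces adjacent to $e$. For a general function $g$ on $F$, the value $g(f_0)$ is irrelevant (it is set to $0$)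 in $\langle g,(-\Delta)^{-1}g\rangle$. Coulomb gas. $\mathbb P^{Coul}_\beta$ is the law of the random integer-valued 2-form $q$ with $\mathbb P^{Coul}_\beta(q)\propto\exp\big(-\tfrac{(2\pi)^2\beta}{2}\langle q,(-\Delta)^{-1}q\rangle\big)$. (The expectation in the claim is real because the law of $q$ is symmetric under $q\mapsto -q$.) Error function. An integer-valued Gaussian with parameters $(a,\beta)$ is a $\mathbb Z$-valued $X$ with $\mathbb P^{IG}_{\beta,a}[X=k]\propto e^{-\frac\beta2(k-a)^2}$; $\operatorname{Var}^{IG}(a,\beta)$ is its variance. $M(\beta):=(2\pi)^2\beta\inf_{a\in[0,1/2]}\operatorname{Var}^{IG}(a,(2\pi)^2\beta)$. *)

theory Defs
  imports "HOL-Probability.Probability" "HOL-Library.Complex_Order"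
begin

section \<open>Graphs embedded in the sphere with a marked face\<close>

text \<open>Each edge comes with a reference orientation; \<open>left_face\<close> and \<open>right_face\<close> are the two
  faces adjacent to it. Edges are abstract, so parallel edges (of the graph and of its dual)
  are allowed.\<close>

record ('v, 'e, 'f) embedded_graph =
  vertices :: "'v set"
  edges :: "'e set"
  faces :: "'f set"
  tail :: "'e \<Rightarrow> 'v"
  head :: "'e \<Rightarrow> 'v"
  left_face :: "'e \<Rightarrow> 'f"
  right_face :: "'e \<Rightarrow> 'f"
  marked_face :: "'f"

subsection \<open>2-forms and the Laplacian of the dual graph\<close>

text \<open>Functions on faces are total functions on the type of faces, so 2-forms are also required
  to vanish at those elements of the type that are not faces.\<close>

definition two_forms :: "('v, 'e, 'f) embedded_graph \<Rightarrow> ('f \<Rightarrow> 'a::zero) set" where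
  "two_forms G = {g. g (marked_face G) = 0 \<and> (\<forall>f. f \<notin> faces G \<longrightarrow> g f = 0)}"

definition form_inner :: "('v, 'e, 'f) embedded_graph \<Rightarrow> ('f \<Rightarrow> real) \<Rightarrow> ('f \<Rightarrow> real) \<Rightarrow> real" where
  "form_inner G g h = (\<Sum>f\<in>faces G. g f * h f)"

definition to_two_form :: "('v, 'e, 'f) embedded_graph \<Rightarrow> ('f \<Rightarrow> real) \<Rightarrow> 'f \<Rightarrow> real" where
  "to_two_form G g = (\<lambda>f. if f \<in> faces G \<and> f \<noteq> marked_face G then g f else 0)"

text \<open>An edge contributes to the Laplacian at both of its adjacent faces; a face sharing several
  edges with another one therefore sees it with the corresponding multiplicity.\<close>

definition laplacian :: "('v, 'e, 'f) embedded_graph \<Rightarrow> ('f \<Rightarrow> real) \<Rightarrow> 'f \<Rightarrow> real" where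
  "laplacian G g = to_two_form G (\<lambda>f.
     (\<Sum>e\<in>{e \<in> edges G. left_face G e = f}. g (right_face G e) - g f) +
     (\<Sum>e\<in>{e \<in> edges G. right_face G e = f}. g (left_face G e) - g f))"

definition inv_laplacian :: "('v, 'e, 'f) embedded_graph \<Rightarrow> ('f \<Rightarrow> real) \<Rightarrow> 'f \<Rightarrow> real" where
  "inv_laplacian G g = inv_into (two_forms G) (laplacian G) (to_two_form G g)"

definition inv_neg_laplacian :: "('v, 'e, 'f) embedded_graph \<Rightarrow> ('f \<Rightarrow> real) \<Rightarrow> 'f \<Rightarrow> real" where
  "inv_neg_laplacian G g =
     inv_into (two_forms G) (\<lambda>h f. - laplacian G h f) (to_two_form G g)"

lemma form_inner_neg_laplacian:
  assumes "finite (edges G)" "finite (faces G)"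
    and faces: "\<And>e. e \<in> edges G \<Longrightarrow> left_face G e \<in> faces G \<and> right_face G e \<in> faces G"
    and g: "g \<in> two_forms G"
  shows "form_inner G g (\<lambda>f. - laplacian G g f) =
    (\<Sum>e\<in>edges G. (g (left_face G e) - g (right_face G e))\<^sup>2)"
proof -
  let ?l = "left_face G" and ?r = "right_face G"
  have "form_inner G g (\<lambda>f. - laplacian G g f) =
      (\<Sum>f\<in>faces G. (\<Sum>e\<in>{e \<in> edges G. ?l e = f}. g (?l e) * (g (?l e) - g (?r e))) +
        (\<Sum>e\<in>{e \<in> edges G. ?r e = f}. g (?r e) * (g (?r e) - g (?l e))))"
    unfolding form_inner_def
  proof (rule sum.cong[OF refl])
    fix f assume "f \<in> faces G"
    show "g f * - laplacian G g f =
      (\<Sum>e\<in>{e \<in> edges G. ?l e = f}. g (?l e) * (g (?l e) - g (?r e))) +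
      (\<Sum>e\<in>{e \<in> edges G. ?r e = f}. g (?r e) * (g (?r e) - g (?l e)))"
    proof (cases "f = marked_face G")
      case True
      then have "g f = 0" using g by (simp add: two_forms_def)
      then show ?thesis by (simp add: sum.neutral)
    next
      case False
      have "(\<Sum>e\<in>{e \<in> edges G. ?l e = f}. g (?l e) * (g (?l e) - g (?r e))) =
          - g f * (\<Sum>e\<in>{e \<in> edges G. ?l e = f}. g (?r e) - g f)"
        unfolding sum_distrib_left by (rule sum.cong) (auto simp: algebra_simps)
      moreover have "(\<Sum>e\<in>{e \<in> edges G. ?r e = f}. g (?r e) * (g (?r e) - g (?l e))) =
          - g f * (\<Sum>e\<in>{e \<in> edges G. ?r e = f}. g (?l e) - g f)"
        unfolding sum_distrib_left by (rule sum.cong) (auto simp: algebra_simps)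
      ultimately show ?thesis
        using False \<open>f \<in> faces G\<close>
        by (simp add: laplacian_def to_two_form_def algebra_simps)
    qed
  qed
  also have "\<dots> = (\<Sum>e\<in>edges G. g (?l e) * (g (?l e) - g (?r e))) +
      (\<Sum>e\<in>edges G. g (?r e) * (g (?r e) - g (?l e)))"
    unfolding sum.distrib using assms(1,2) faces
    by (intro arg_cong2[of _ _ _ _ "(+)"] sum.group) auto
  also have "\<dots> = (\<Sum>e\<in>edges G. (g (?l e) - g (?r e))\<^sup>2)"
    unfolding sum.distrib[symmetric] by (simp add: power2_eq_square algebra_simps)
  finally show ?thesis .
qed

section \<open>The square-grid boxes\<close>

text \<open>An edge of \<open>\<int>\<^sup>2\<close> is an ordered pair of nearest neighbours, oriented to the right or upwards.
  A face of \<open>\<int>\<^sup>2\<close> is named by the lower left corner of the unit square: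
  \<open>(i, j)\<close> stands for \<open>]i, i+1[ \<times> ]j, j+1[\<close>.\<close>

definition lattice_edges :: "((int \<times> int) \<times> (int \<times> int)) set" where
  "lattice_edges = {((i, j), (i + 1, j)) | i j. True} \<union> {((i, j), (i, j + 1)) | i j. True}"

fun left_square :: "(int \<times> int) \<times> (int \<times> int) \<Rightarrow> int \<times> int" where
  "left_square ((i, j), (k, l)) = (if l = j then (i, j) else (i - 1, j))"

fun right_square :: "(int \<times> int) \<times> (int \<times> int) \<Rightarrow> int \<times> int" where
  "right_square ((i, j), (k, l)) = (if l = j then (i, j - 1) else (i, j))"

definition box :: "nat \<Rightarrow> (int \<times> int) set" where
  "box n = {- int n..int n} \<times> {- int n..int n}"

definition collapse_outside :: "'a set \<Rightarrow> 'a \<Rightarrow> 'a option" where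
  "collapse_outside S x = (if x \<in> S then Some x else None)"

type_synonym lattice_graph =
  "((int \<times> int) option, (int \<times> int) \<times> (int \<times> int), (int \<times> int) option) embedded_graph"

text \<open>Free boundary conditions: the faces are the unit squares with all corners in the box, and
  the unbounded face \<open>None\<close>.\<close>

definition inner_squares :: "nat \<Rightarrow> (int \<times> int) set" where
  "inner_squares n = {- int n..int n - 1} \<times> {- int n..int n - 1}"

definition free_box :: "nat \<Rightarrow> lattice_graph" where
  "free_box n = \<lparr>
     vertices = Some ` box n,
     edges = {e \<in> lattice_edges. fst e \<in> box n \<and> snd e \<in> box n},
     faces = insert None (Some ` inner_squares n),
     tail = Some \<circ> fst,
     head = Some \<circ> snd,
     left_face = collapse_outside (inner_squares n) \<circ> left_square,
     right_face = collapse_outside (inner_squares n) \<circ> right_square,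
     marked_face = None \<rparr>"

text \<open>Zero boundary conditions: all vertices of \<open>\<int>\<^sup>2\<close> outside the box are collapsed to the single
  vertex \<open>\<infinity>\<close>, here \<open>None\<close>, and the edges of \<open>\<int>\<^sup>2\<close> with at least one endpoint in the box are
  kept. This gives one edge to \<open>\<infinity>\<close> for each non-corner boundary vertex and two parallel ones for
  each corner. The faces correspond to the unit squares with at least one corner in the box (those
  at a corner of the box become digons), so that the dual graph is the square grid with
  \<open>2n+2\<close> by \<open>2n+2\<close> vertices.\<close>

definition touching_squares :: "nat \<Rightarrow> (int \<times> int) set" where
  "touching_squares n = {- int n - 1..int n} \<times> {- int n - 1..int n}"

definition zero_box :: "nat \<Rightarrow> (int \<times> int) option \<Rightarrow> lattice_graph" where
  "zero_box n f\<^sub>0 = \<lparr>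
     vertices = insert None (Some ` box n),
     edges = {e \<in> lattice_edges. fst e \<in> box n \<or> snd e \<in> box n},
     faces = Some ` touching_squares n,
     tail = collapse_outside (box n) \<circ> fst,
     head = collapse_outside (box n) \<circ> snd,
     left_face = Some \<circ> left_square,
     right_face = Some \<circ> right_square,
     marked_face = f\<^sub>0 \<rparr>"

text \<open>There is no single central face, but there are four faces around the origin, and any of them
  may be the marked one.\<close>

definition central_faces :: "(int \<times> int) option set" where
  "central_faces = Some ` ({-1, 0} \<times> {-1, 0})"

definition boxes :: "nat \<Rightarrow> lattice_graph set" where
  "boxes n = insert (free_box n) (zero_box n ` central_faces)"

section \<open>The Coulomb gas and the integer-valued Gaussian\<close>

text \<open>The discrete probability law on \<open>A\<close> proportional to the weight \<open>w\<close>.\<close>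

definition gibbs_pmf :: "'a set \<Rightarrow> ('a \<Rightarrow> real) \<Rightarrow> 'a pmf" where
  "gibbs_pmf A w = embed_pmf (\<lambda>x. indicator A x * w x / infsum w A)"

lemma pmf_gibbs_pmf:
  assumes "w summable_on A" "\<And>x. x \<in> A \<Longrightarrow> 0 \<le> w x" "infsum w A > 0"
  shows "pmf (gibbs_pmf A w) x = indicator A x * w x / infsum w A"
  unfolding gibbs_pmf_def
proof (rule pmf_embed_pmf)
  let ?Z = "infsum w A"
  show nonneg: "0 \<le> indicator A x * w x / ?Z" for x
    using assms(2,3) by (auto simp: indicator_def)
  have "integrable (count_space A) w"
    using assms(1,2) abs_summable_equivalent[of w A] summable_on_iff_abs_summable_on_real[of w A]
    by (simp add: abs_summable_on_def)
  then have "(\<integral>\<^sup>+x. ennreal (w x) \<partial>count_space A) = ennreal (integral\<^sup>L (count_space A) w)"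
    using assms(2) by (intro nn_integral_eq_integral) (auto simp: AE_count_space)
  also have "integral\<^sup>L (count_space A) w = ?Z"
    using infsetsum_infsum[of w A] \<open>integrable (count_space A) w\<close>
    by (simp add: infsetsum_def abs_summable_on_def)
  finally have *: "(\<integral>\<^sup>+x. ennreal (w x) \<partial>count_space A) = ennreal ?Z" .
  have "(\<integral>\<^sup>+x. ennreal (indicator A x * w x / ?Z) \<partial>count_space UNIV) =
      (\<integral>\<^sup>+x. ennreal (w x / ?Z) * indicator A x \<partial>count_space UNIV)"
    by (intro nn_integral_cong) (auto simp: indicator_def)
  also have "\<dots> = (\<integral>\<^sup>+x. ennreal (w x / ?Z) \<partial>count_space A)"
    by (simp add: nn_integral_count_space_indicator)
  also have "\<dots> = (\<integral>\<^sup>+x. ennreal (w x) / ennreal ?Z \<partial>count_space A)"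
    using assms(2,3) by (intro nn_integral_cong) (simp add: divide_ennreal)
  also have "\<dots> = 1"
    using * assms(3) by (simp add: nn_integral_divide divide_ennreal)
  finally show "(\<integral>\<^sup>+x. ennreal (indicator A x * w x / ?Z) \<partial>count_space UNIV) = 1" .
qed

definition coulomb_gas :: "('v, 'e, 'f) embedded_graph \<Rightarrow> real \<Rightarrow> ('f \<Rightarrow> int) pmf" where
  "coulomb_gas G \<beta> = gibbs_pmf (two_forms G) (\<lambda>q. exp (- ((2 * pi)\<^sup>2 * \<beta> / 2) *
     form_inner G (\<lambda>f. real_of_int (q f)) (inv_neg_laplacian G (\<lambda>f. real_of_int (q f)))))"

definition integer_gaussian :: "real \<Rightarrow> real \<Rightarrow> int pmf" where
  "integer_gaussian a \<beta> = gibbs_pmf UNIV (\<lambda>k. exp (- (\<beta> / 2) * (real_of_int k - a)\<^sup>2))"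

definition Var_IG :: "real \<Rightarrow> real \<Rightarrow> real" where
  "Var_IG a \<beta> = measure_pmf.variance (integer_gaussian a \<beta>) real_of_int"

definition M_err :: "real \<Rightarrow> real" where
  "M_err \<beta> = (2 * pi)\<^sup>2 * \<beta> * (INF a\<in>{0..1/2}. Var_IG a ((2 * pi)\<^sup>2 * \<beta>))"

text \<open>Expectations of complex functions are compared with real numbers in the partial order on
  \<open>complex\<close>, in which \<open>z \<le> complex_of_real r\<close> means that \<open>z\<close> is real and at most \<open>r\<close>.\<close>

end

theory Submission
  imports Defs
begin

text \<open>
  The divergence of an integer 1-form \<open>m\<close> on the edges is an integer 2-form. A Gaussian weight
  \<open>exp (- b/2 |m + w|\<^sup>2)\<close> with \<open>b = (2\<pi>)\<^sup>2\<beta>\<close>, summed over all \<open>m\<close> with divergence \<open>q\<close> and integrated over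
  the divergence-free real 1-forms \<open>w\<close> modulo the integer ones, is a full Gaussian integral over an affine
  space, hence a constant times the Coulomb weight of \<open>q\<close> (Pythagoras: the minimiser is a gradient).
  A spanning tree of the dual graph provides integral coordinates on the divergence-free forms.
  For fixed \<open>w\<close> the \<open>m(e)\<close> are independent integer-valued Gaussians, and
  \<open>\<Delta>\<^sup>-\<^sup>1q(f) - \<Delta>\<^sup>-\<^sup>1q(f')\<close> is the pairing of \<open>m\<close> with the gradient \<open>t\<close> of the potential of a dipole.
  Every dual edge lies on a cycle of length at most 4, so \<open>|t(e)| \<le> 3/4\<close>, and then the two
  most likely values of \<open>m(e)\<close> already force its characteristic function to be at most
  \<open>exp (- exp (- b/2) t(e)\<^sup>2)\<close>. Since \<open>Var\<^sup>I\<^sup>G(0, b) \<le> 4 exp (- b/2)\<close>, the claim holds with \<open>K = 1\<close>.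
\<close>

section \<open>Integer-valued Gaussians in one dimension\<close>

text \<open>The decay gained at an edge is governed by sin^2 (pi t), which dominates a multiple of
  t^2 only while |t| stays away from 1. A bridge of the dual graph can carry |t| = 1 and then yields
  no decay; short detours rule this out. The worst centre of an integer-valued Gaussian is an
  integer, where the next most likely value has relative weight exp (- b/2). This is also the order
  of the variance at centre 0. Per unit of dipole energy the target exponent is at most a quarter of
  that variance, so the bound 4 exp (- b/2) matches the decay with no constant left over. The
  threshold 12 for b comes from pi > 3 and \<beta> \<ge> 1/3. Estimates concern 1 + cos instead of
  the complex exponential: it is nonnegative, so sums and integrals are interchanged in
  \<open>ennreal\<close> without prior integrability, and the Gaussian constant is cancelled instead
  of computed.\<close>

definition ig_weight :: "real \<Rightarrow> real \<Rightarrow> int \<Rightarrow> real" where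
  "ig_weight b x k = exp (- (b / 2) * (real_of_int k - x)\<^sup>2)"

lemma ig_weight_pos: "0 < ig_weight b x k"
  by (simp add: ig_weight_def)

section \<open>Mass of the two leading integers and the characteristic function\<close>

lemma exp_minus_half_le:
  assumes "12 \<le> (b::real)" shows "exp (- (b / 2)) \<le> 1 / 16"
proof -
  have "exp (- (b / 2)) \<le> exp (- real 6)"
    using assms by simp
  also have "\<dots> = 1 / (exp 1) ^ 6"
    by (simp add: exp_minus field_simps flip: exp_of_nat_mult)
  also have "\<dots> \<le> 1 / 2 ^ 6"
  proof (intro divide_left_mono power_mono)
    show "(2::real) \<le> exp 1" using exp_ge_add_one_self[of 1] by simp
  qed auto
  finally show ?thesis by simp
qed

lemma has_sum_geometric_from_1:
  assumes "0 \<le> (r::real)" "r < 1"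
  shows "((\<lambda>n. r ^ n) has_sum (r / (1 - r))) {1..}"
proof -
  have "(\<lambda>n. r * r ^ n) sums (r * (1 / (1 - r)))"
    using assms by (intro sums_mult geometric_sums) auto
  then have "((\<lambda>n. r ^ Suc n) has_sum (r / (1 - r))) UNIV"
    using assms by (intro sums_nonneg_imp_has_sum) auto
  then have "((\<lambda>n. r ^ n) has_sum (r / (1 - r))) (Suc ` UNIV)"
    by (subst has_sum_reindex) (auto simp: o_def)
  also have "Suc ` UNIV = {1..}"
    by (metis One_nat_def atLeast_Suc_greaterThan greaterThan_0)
  finally show ?thesis .
qed

text \<open>With r = exp (- b/2) \<le> 1/16 the tail r / (1 - r) is at most 1/15, rounded up to
  1/10. The map \<open>g\<close> enumerates one side of the integers.\<close>

lemma geometric_tail_bound: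
  fixes w :: "int \<Rightarrow> real"
  assumes b: "12 \<le> b" and inj: "inj_on g {1..}" and C: "0 \<le> C"
    and le: "\<And>n. 1 \<le> n \<Longrightarrow> 0 \<le> w (g n) \<and> w (g n) \<le> C * exp (- (b / 2)) ^ n"
  shows "w summable_on (g ` {1::nat..})" "infsum w (g ` {1::nat..}) \<le> C / 10"
proof -
  define r where "r = exp (- (b / 2))"
  have r: "0 \<le> r" "r \<le> 1 / 16" using exp_minus_half_le[OF b] by (auto simp: r_def)
  have hs: "((\<lambda>n. C * r ^ n) has_sum (C * (r / (1 - r)))) {1..}"
    using r by (intro has_sum_cmult_right has_sum_geometric_from_1) auto
  have s: "(w \<circ> g) summable_on {1..}"
    using le by (intro summable_on_comparison_test[OF has_sum_imp_summable[OF hs]]) (auto simp: r_def)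
  then show "w summable_on (g ` {1::nat..})"
    by (simp only: summable_on_reindex[OF inj])
  have "infsum w (g ` {1::nat..}) = infsum (w \<circ> g) {1..}"
    by (rule infsum_reindex[OF inj])
  also have "\<dots> \<le> infsum (\<lambda>n. C * r ^ n) {1..}"
    using le by (intro infsum_mono s has_sum_imp_summable[OF hs]) (auto simp: r_def)
  also have "\<dots> = C * (r / (1 - r))"
    by (rule infsumI[OF hs])
  also have "\<dots> \<le> C * (1 / 10)"
    using r C by (intro mult_left_mono) (auto simp: field_simps)
  finally show "infsum w (g ` {1::nat..}) \<le> C / 10" by simp
qed

lemma int_split: "(UNIV :: int set) = {0, 1} \<union> ((\<lambda>n. - int n) ` {1..} \<union> (\<lambda>n. int n + 1) ` {1..})"
proof -
  have "k \<in> {0, 1} \<union> ((\<lambda>n. - int n) ` {1..} \<union> (\<lambda>n. int n + 1) ` {1..})" for k :: int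
  proof -
    consider "k = 0" | "k = 1" | "k \<le> -1" | "k \<ge> 2" by linarith
    then show ?thesis
    proof cases
      case 3
      then show ?thesis by (intro UnI2 UnI1 image_eqI[of _ _ "nat (- k)"]) auto
    next
      case 4
      then show ?thesis by (intro UnI2 image_eqI[of _ _ "nat (k - 1)"]) auto
    qed auto
  qed
  then show ?thesis by blast
qed

text \<open>The centre lies between 0 and 1. Going n steps further out on either side costs at least
  a factor exp (- b/2)^n, so each tail is at most a tenth of the weight at which it starts.\<close>

lemma ig_weight_sum_unit:
  assumes b: "12 \<le> b" and a: "0 \<le> a" "a < 1"
  shows "ig_weight b a summable_on UNIV"
    and "infsum (ig_weight b a) UNIV \<le> 11 / 10 * (ig_weight b a 0 + ig_weight b a 1)"
    and "infsum (ig_weight b a) (- {0, 1}) =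
      infsum (ig_weight b a) UNIV - (ig_weight b a 0 + ig_weight b a 1)"
proof -
  let ?w = "ig_weight b a"
  let ?L = "(\<lambda>n. - int n) ` {1..}" and ?R = "(\<lambda>n. int n + 1) ` {1..}"
  have L: "?w (- int n) \<le> ?w 0 * exp (- (b / 2)) ^ n" if "1 \<le> n" for n
  proof -
    have "real n \<le> (real n)\<^sup>2" using that by (simp add: power2_eq_square)
    moreover have "0 \<le> real n * a" using a by simp
    ultimately have "a\<^sup>2 + real n \<le> (real n + a)\<^sup>2" by (simp add: power2_eq_square algebra_simps)
    then have "b / 2 * (a\<^sup>2 + real n) \<le> b / 2 * (real n + a)\<^sup>2"
      using b by (intro mult_left_mono) auto
    moreover have "(- real n - a)\<^sup>2 = (real n + a)\<^sup>2" by (simp add: power2_eq_square algebra_simps)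
    ultimately show ?thesis
      by (simp add: ig_weight_def algebra_simps flip: exp_of_nat_mult exp_add)
  qed
  have R: "?w (int n + 1) \<le> ?w 1 * exp (- (b / 2)) ^ n" if "1 \<le> n" for n
  proof -
    have "real n \<le> (real n)\<^sup>2" using that by (simp add: power2_eq_square)
    moreover have "0 \<le> real n * (1 - a)" using a by simp
    ultimately have "(1 - a)\<^sup>2 + real n \<le> (real n + 1 - a)\<^sup>2"
      by (simp add: power2_eq_square algebra_simps)
    then have "b / 2 * ((1 - a)\<^sup>2 + real n) \<le> b / 2 * (real n + 1 - a)\<^sup>2"
      using b by (intro mult_left_mono) auto
    then show ?thesis
      by (simp add: ig_weight_def algebra_simps flip: exp_of_nat_mult exp_add)
  qed
  have nn: "0 \<le> ?w k" for k using ig_weight_pos[of b a k] by simp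
  note TL = geometric_tail_bound[of b "\<lambda>n. - int n" "?w 0" ?w, OF b _ nn]
  note TR = geometric_tail_bound[of b "\<lambda>n. int n + 1" "?w 1" ?w, OF b _ nn]
  have sL: "?w summable_on ?L" "infsum ?w ?L \<le> ?w 0 / 10"
    by (rule TL; use L nn in \<open>auto simp: inj_on_def\<close>)+
  have sR: "?w summable_on ?R" "infsum ?w ?R \<le> ?w 1 / 10"
    by (rule TR; use R nn in \<open>auto simp: inj_on_def\<close>)+
  have dis: "?L \<inter> ?R = {}" "{0, 1} \<inter> (?L \<union> ?R) = {}" by auto
  have sLR: "?w summable_on (?L \<union> ?R)"
    using sL sR by (intro summable_on_Un_disjoint dis)
  show "?w summable_on UNIV"
    by (subst int_split) (intro summable_on_Un_disjoint sLR dis; simp)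
  have iLR: "infsum ?w (?L \<union> ?R) = infsum ?w ?L + infsum ?w ?R"
    by (intro infsum_Un_disjoint sL sR dis)
  have Z: "infsum ?w UNIV = (?w 0 + ?w 1) + infsum ?w (?L \<union> ?R)"
    by (subst int_split, subst infsum_Un_disjoint) (use sLR dis in auto)
  have "p + q + (l + r) \<le> 11 / 10 * (p + q)" if "l \<le> p / 10" "r \<le> q / 10" for p q l r :: real
    using that by simp
  from this[OF sL(2) sR(2)] show "infsum ?w UNIV \<le> 11 / 10 * (?w 0 + ?w 1)"
    unfolding Z iLR .
  have "- {0, 1} = UNIV - {0, 1 :: int}" by (rule Compl_eq_Diff_UNIV)
  also have "\<dots> = ?L \<union> ?R"
    by (subst int_split) (use dis(2) in blast)
  finally show "infsum ?w (- {0, 1}) = infsum ?w UNIV - (?w 0 + ?w 1)"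
    unfolding Z by (simp only: add_diff_cancel_left')
qed

text \<open>With A = p + q and u the subtracted term, the squared modulus is A^2 - 2 A u, which is
  at most (A - u)^2. Taking roots requires u \<le> A, that is, 2 p q \<le> (p + q)^2.\<close>

lemma two_point_norm_bound:
  fixes p q s :: real
  assumes "0 < p" "0 < q"
  shows "norm (of_real p + of_real q * cis (2 * s)) \<le> p + q - 2 * p * q * (sin s)\<^sup>2 / (p + q)"
proof -
  let ?u = "2 * p * q * (sin s)\<^sup>2 / (p + q)"
  have "(norm (of_real p + of_real q * cis (2 * s)))\<^sup>2 = (p + q * cos (2 * s))\<^sup>2 + (q * sin (2 * s))\<^sup>2"
    by (simp add: cmod_power2)
  also have "\<dots> = p\<^sup>2 + 2 * p * q * cos (2 * s) + q\<^sup>2 * ((sin (2 * s))\<^sup>2 + (cos (2 * s))\<^sup>2)"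
    unfolding power2_eq_square by algebra
  also have "\<dots> = (p + q)\<^sup>2 - 4 * p * q * (sin s)\<^sup>2"
    by (simp only: sin_cos_squared_add, simp only: cos_double_sin)
      (simp add: power2_eq_square algebra_simps)
  also have "\<dots> = (p + q)\<^sup>2 - 2 * (p + q) * ?u"
    using assms by (simp add: field_simps)
  also have "\<dots> \<le> (p + q - ?u)\<^sup>2"
    unfolding power2_diff[of "p + q"] by simp
  finally have *: "(norm (of_real p + of_real q * cis (2 * s)))\<^sup>2 \<le> (p + q - ?u)\<^sup>2" .
  have "2 * p * q * (sin s)\<^sup>2 \<le> 2 * p * q * 1"
    using assms by (intro mult_left_mono) (auto simp: abs_square_le_1)
  also have "\<dots> \<le> (p + q) * (p + q)" using assms by (simp add: algebra_simps)
  finally have "?u \<le> p + q" using assms by (simp add: field_simps)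
  then show ?thesis by (intro power2_le_imp_le[OF *]) simp
qed

text \<open>Between 1/4 and 3/4 the cosine of 2 pi t is nonpositive, so sin^2 is at least 1/2, more
  than 5/8 * 9/16. Below 1/4 the cubic Taylor bound even gives sin (pi t) \<ge> t.\<close>

lemma sin_pi_ge:
  assumes "0 \<le> t" "t \<le> (3 / 4 :: real)"
  shows "5 / 8 * t\<^sup>2 \<le> (sin (pi * t))\<^sup>2"
proof -
  have t2: "t\<^sup>2 \<le> (3/4)\<^sup>2" using assms by (intro power_mono) auto
  have s4: "1 / 2 \<le> (sin (pi * t))\<^sup>2" if "1 / 4 \<le> t"
  proof -
    have "cos (pi * (2 * t)) \<le> 0"
    proof -
      have "- cos (2 * pi * t) = cos (2 * pi * t - pi)" by simp
      moreover have "0 \<le> cos (2 * pi * t - pi)"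
      proof (rule cos_ge_zero)
        have "2 * pi * (1 / 4) \<le> 2 * pi * t" using that by (intro mult_left_mono) auto
        then show "- (pi / 2) \<le> 2 * pi * t - pi" by linarith
        have "2 * pi * t \<le> 2 * pi * (3 / 4)" using assms by (intro mult_left_mono) auto
        then show "2 * pi * t - pi \<le> pi / 2" by linarith
      qed
      ultimately show ?thesis by (simp add: algebra_simps)
    qed
    moreover have "cos (pi * (2 * t)) = 1 - 2 * (sin (pi * t))\<^sup>2"
      using cos_double_sin[of "pi * t"] by (simp add: algebra_simps)
    ultimately show ?thesis by simp
  qed
  show ?thesis
  proof (cases "1 / 4 \<le> t")
    case True
    show ?thesis using s4[OF True] t2 by (simp add: power2_eq_square)
  next
    case False
    have pt: "0 \<le> pi * t" "pi * t \<le> 1"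
      using assms False pi_less_4 mult_mono[of pi 4 t "1/4"] by auto
    have "t \<le> sin (pi * t)"
    proof -
      have "\<bar>sin (pi * t) - pi * t\<bar> \<le> (pi * t) ^ 3 / 6"
        using Maclaurin_sin_bound[of "pi * t" 3] pt
        by (simp add: numeral_3_eq_3 sin_coeff_def fact_numeral field_simps)
      then have "pi * t - sin (pi * t) \<le> (pi * t) ^ 3 / 6" by linarith
      moreover have "(pi * t) ^ 3 \<le> pi * t"
        using power_decreasing[of 1 3 "pi * t"] pt by simp
      moreover have "3 * t \<le> pi * t" using assms pi_gt3 by (intro mult_right_mono) auto
      ultimately show ?thesis using assms by linarith
    qed
    then have "t\<^sup>2 \<le> (sin (pi * t))\<^sup>2" using assms by (intro power_mono) auto
    moreover have "0 \<le> t\<^sup>2" by simp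
    ultimately show ?thesis by linarith
  qed
qed

text \<open>Only the interference between the values 0 and 1 is exploited; all other values enter
  through their absolute value. The constants close because 11/10 * (17/16)^2 \<le> 2 * 5/8.\<close>

lemma ig_char_bound_unit:
  assumes b: "12 \<le> b" and a: "0 \<le> a" "a < 1" and t: "\<bar>t\<bar> \<le> 3 / 4"
  shows "norm (\<Sum>\<^sub>\<infinity>k. of_real (ig_weight b a k) * cis (2 * (pi * t) * real_of_int k))
    \<le> (1 - exp (- (b / 2)) * t\<^sup>2) * infsum (ig_weight b a) UNIV"
proof -
  let ?w = "ig_weight b a" and ?e = "exp (- (b / 2))"
  let ?f = "\<lambda>k. of_real (?w k) * cis (2 * (pi * t) * real_of_int k)"
  define P Q Z where "P = ?w 0" and "Q = ?w 1" and "Z = infsum ?w UNIV"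
  have PQ: "0 < P" "0 < Q" by (auto simp: P_def Q_def ig_weight_pos)
  note W = ig_weight_sum_unit[OF b a]
  have nn: "0 \<le> ?w k" for k using ig_weight_pos[of b a k] by simp
  have nf: "norm (?f k) = ?w k" for k using nn by (simp add: norm_mult)
  have sf: "?f summable_on A" for A
    by (rule abs_summable_summable) (simp only: nf summable_on_subset_banach[OF W(1)] subset_UNIV)
  have U: "(UNIV :: int set) = {0, 1} \<union> - {0, 1}" by auto
  have "(\<Sum>\<^sub>\<infinity>k. ?f k) = infsum ?f {0, 1} + infsum ?f (- {0, 1})"
    by (subst U) (rule infsum_Un_disjoint[OF sf sf Compl_disjoint])
  then have n: "norm (\<Sum>\<^sub>\<infinity>k. ?f k) \<le> norm (infsum ?f {0, 1}) + norm (infsum ?f (- {0, 1}))"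
    by (simp only: norm_triangle_ineq)
  have "infsum ?f {0, 1} = of_real P + of_real Q * cis (2 * (pi * t))"
    by (simp add: P_def Q_def)
  then have n1: "norm (infsum ?f {0, 1}) \<le> P + Q - 2 * P * Q * (sin (pi * t))\<^sup>2 / (P + Q)"
    using two_point_norm_bound[OF PQ, of "pi * t"] by (simp only:)
  have n2: "norm (infsum ?f (- {0, 1})) \<le> infsum ?w (- {0, 1})"
    using norm_infsum_bound[of ?f "- {0, 1}"] summable_on_subset_banach[OF W(1) subset_UNIV]
    by (simp only: nf simp_thms)
  have 1: "norm (\<Sum>\<^sub>\<infinity>k. ?f k)
      \<le> (P + Q - 2 * P * Q * (sin (pi * t))\<^sup>2 / (P + Q)) + (Z - (P + Q))"
    using n n1 n2 W(3) unfolding P_def[symmetric] Q_def[symmetric] Z_def[symmetric] by linarith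
  have s: "5 / 8 * t\<^sup>2 \<le> (sin (pi * t))\<^sup>2"
    using sin_pi_ge[of "\<bar>t\<bar>"] t by (cases "0 \<le> t") auto
  have e: "0 < ?e" "?e \<le> 1 / 16" using exp_minus_half_le[OF b] by auto
  \<comment> \<open>Since P/Q = exp (b/2 - b a), each square becomes P Q times one exponential. The
    aim is P Q / (P + Q)^2 \<ge> e / (1 + e)^2 for e = exp (- b/2), with equality at a = 0.\<close>
  have "(P + Q)\<^sup>2 * ?e = P * Q * (exp (- b * a) + exp (- b * (1 - a)) + 2 * ?e)"
  proof -
    have "P\<^sup>2 * ?e = P * Q * exp (- b * a)" "Q\<^sup>2 * ?e = P * Q * exp (- b * (1 - a))"
      unfolding P_def Q_def ig_weight_def power2_eq_square exp_add[symmetric]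
      by (auto simp: field_simps power2_eq_square)
    moreover have "(P + Q)\<^sup>2 * ?e = P\<^sup>2 * ?e + Q\<^sup>2 * ?e + P * Q * (2 * ?e)"
      by (simp add: power2_eq_square algebra_simps)
    ultimately show ?thesis by (simp only: distrib_left)
  qed
  also have "\<dots> \<le> P * Q * (1 + ?e)\<^sup>2"
  proof (intro mult_left_mono)
    let ?x = "exp (- b * a)" and ?y = "exp (- b * (1 - a))"
    \<comment> \<open>As x y = e^2, the desired x + y + 2 e \<le> (1 + e)^2 is just (1 - x) (1 - y)
      \<ge> 0.\<close>
    have "?x \<le> 1" "?y \<le> 1" using a b by (auto intro!: mult_nonneg_nonneg)
    then have "0 \<le> (1 - ?x) * (1 - ?y)" by simp
    moreover have "?x * ?y = ?e\<^sup>2"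
      by (simp add: power2_eq_square algebra_simps flip: exp_add)
    ultimately show "?x + ?y + 2 * ?e \<le> (1 + ?e)\<^sup>2"
      by (simp add: power2_eq_square algebra_simps)
  qed (use PQ in auto)
  also have "\<dots> \<le> P * Q * (17 / 16)\<^sup>2"
    using PQ e by (intro mult_left_mono power_mono) auto
  finally have 2: "(P + Q)\<^sup>2 * ?e \<le> P * Q * (289 / 256)" by (simp add: power2_eq_square)
  have "?e * t\<^sup>2 * Z * (P + Q) \<le> ?e * t\<^sup>2 * (11 / 10 * (P + Q)) * (P + Q)"
    using W(2) PQ by (intro mult_right_mono mult_left_mono) (auto simp: P_def Q_def Z_def)
  also have "\<dots> = 11 / 10 * t\<^sup>2 * ((P + Q)\<^sup>2 * ?e)"
    by (simp add: power2_eq_square)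
  also have "\<dots> \<le> 11 / 10 * t\<^sup>2 * (P * Q * (289 / 256))"
    using 2 by (intro mult_left_mono) auto
  also have "\<dots> \<le> 2 * P * Q * (5 / 8 * t\<^sup>2)" using PQ by (simp add: mult.commute mult.left_commute)
  also have "\<dots> \<le> 2 * P * Q * (sin (pi * t))\<^sup>2"
    using s PQ by (intro mult_left_mono) auto
  finally have "?e * t\<^sup>2 * Z \<le> 2 * P * Q * (sin (pi * t))\<^sup>2 / (P + Q)"
    using PQ by (simp add: field_simps)
  moreover have "(1 - ?e * t\<^sup>2) * Z = Z - ?e * t\<^sup>2 * Z" by (simp only: left_diff_distrib mult_1)
  ultimately show ?thesis using 1 unfolding Z_def[symmetric] by linarith
qed

lemma ig_weight_reindex:
  "ig_weight b x = ig_weight b (x - real_of_int j) \<circ> (\<lambda>k. k - j)"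
  by (auto simp: fun_eq_iff ig_weight_def algebra_simps)

lemma bij_diff_int: "bij (\<lambda>k::int. k - j)"
  by (rule bij_betw_byWitness[of _ "\<lambda>k. k + j"]) auto

text \<open>Shifting by the integer part of \<open>x\<close> reduces to a centre in [0, 1); the
  characteristic function only acquires a phase. The bound 3 rounds up 11/10 * 2.\<close>

lemma
  assumes b: "12 \<le> b"
  shows ig_weight_summable: "ig_weight b x summable_on UNIV"
    and ig_weight_sum_le: "infsum (ig_weight b x) UNIV \<le> 3"
    and ig_char_bound: "\<bar>t\<bar> \<le> 3 / 4 \<Longrightarrow>
      norm (\<Sum>\<^sub>\<infinity>k. of_real (ig_weight b x k) * cis (2 * (pi * t) * real_of_int k))
      \<le> exp (- exp (- (b / 2)) * t\<^sup>2) * infsum (ig_weight b x) UNIV"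
proof -
  define j a where "j = \<lfloor>x\<rfloor>" and "a = x - real_of_int j"
  have a: "0 \<le> a" "a < 1" unfolding a_def j_def by linarith+
  note W = ig_weight_sum_unit[OF b a]
  have w: "ig_weight b x = ig_weight b a \<circ> (\<lambda>k. k - j)"
    unfolding a_def by (rule ig_weight_reindex)
  have B: "bij (\<lambda>k::int. k - j)" by (rule bij_diff_int)
  have inj: "inj (\<lambda>k::int. k - j)" using B bij_is_inj by blast
  have rng: "range (\<lambda>k::int. k - j) = UNIV" using B bij_is_surj by blast
  show "ig_weight b x summable_on UNIV"
    unfolding w using W(1) by (subst summable_on_reindex[symmetric, OF inj]) (simp only: rng)
  have Z: "infsum (ig_weight b x) UNIV = infsum (ig_weight b a) UNIV"
    unfolding w by (subst infsum_reindex[symmetric, OF inj]) (simp only: rng)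
  have "ig_weight b a 0 \<le> 1" "ig_weight b a 1 \<le> 1" using b by (auto simp: ig_weight_def)
  then show "infsum (ig_weight b x) UNIV \<le> 3" using W(2) Z by simp
  assume t: "\<bar>t\<bar> \<le> 3 / 4"
  let ?f = "\<lambda>k. of_real (ig_weight b a k) * cis (2 * (pi * t) * real_of_int k)"
  have "(\<Sum>\<^sub>\<infinity>k. of_real (ig_weight b x k) * cis (2 * (pi * t) * real_of_int k))
     = (\<Sum>\<^sub>\<infinity>k. cis (2 * (pi * t) * real_of_int j) * (?f \<circ> (\<lambda>k. k - j)) k)"
  proof (rule infsum_cong)
    fix k
    have "cis (2 * (pi * t) * real_of_int k) =
        cis (2 * (pi * t) * real_of_int j) * cis (2 * (pi * t) * real_of_int (k - j))"
      unfolding cis_mult by (simp add: right_diff_distrib)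
    then show "of_real (ig_weight b x k) * cis (2 * (pi * t) * real_of_int k)
        = cis (2 * (pi * t) * real_of_int j) * (?f \<circ> (\<lambda>k. k - j)) k"
      unfolding w o_def by (simp only: mult.left_commute)
  qed
  also have "\<dots> = cis (2 * (pi * t) * real_of_int j) * infsum (?f \<circ> (\<lambda>k. k - j)) UNIV"
    by (rule infsum_cmult_right')
  also have "infsum (?f \<circ> (\<lambda>k. k - j)) UNIV = infsum ?f UNIV"
    by (subst infsum_reindex[symmetric, OF inj]) (simp only: rng)
  finally have "norm (\<Sum>\<^sub>\<infinity>k. of_real (ig_weight b x k) * cis (2 * (pi * t) * real_of_int k))
      = norm (infsum ?f UNIV)" by (simp only: norm_mult norm_cis mult_1)
  also have "\<dots> \<le> (1 - exp (- (b / 2)) * t\<^sup>2) * infsum (ig_weight b a) UNIV"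
    by (rule ig_char_bound_unit[OF b a t])
  also have "\<dots> \<le> exp (- exp (- (b / 2)) * t\<^sup>2) * infsum (ig_weight b a) UNIV"
    using exp_ge_add_one_self[of "- exp (- (b / 2)) * t\<^sup>2"]
    by (intro mult_right_mono infsum_nonneg) (auto simp: less_imp_le[OF ig_weight_pos])
  finally show "norm (\<Sum>\<^sub>\<infinity>k. of_real (ig_weight b x k) * cis (2 * (pi * t) * real_of_int k))
      \<le> exp (- exp (- (b / 2)) * t\<^sup>2) * infsum (ig_weight b x) UNIV" by (simp add: Z)
qed

section \<open>The variance at centre 0 and the error function\<close>

lemma infsum_abs_int:
  fixes g :: "nat \<Rightarrow> real"
  assumes g: "(g has_sum s) {1..}" and g0: "g 0 = 0"
  shows "((\<lambda>k. g (nat \<bar>k\<bar>)) has_sum (2 * s)) (UNIV :: int set)"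
proof -
  let ?f = "\<lambda>k::int. g (nat \<bar>k\<bar>)"
  have P: "(?f has_sum s) (int ` {1..})"
    using g by (subst has_sum_reindex) (auto simp: o_def)
  have N: "(?f has_sum s) ((\<lambda>n. - int n) ` {1..})"
    using g by (subst has_sum_reindex) (auto simp: o_def inj_on_def)
  have Z: "(?f has_sum 0) {0}"
    using has_sum_finite[of "{0}" ?f] g0 by simp
  have "(?f has_sum (0 + (s + s))) ({0} \<union> (int ` {1..} \<union> (\<lambda>n. - int n) ` {1..}))"
    by (intro has_sum_Un_disjoint P N Z) auto
  also have "({0} \<union> (int ` {1..} \<union> (\<lambda>n. - int n) ` {1..})) = UNIV"
  proof -
    have "k \<in> {0} \<union> (int ` {1..} \<union> (\<lambda>n. - int n) ` {1..})" for k :: int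
    proof -
      consider "k = 0" | "k \<ge> 1" | "k \<le> -1" by linarith
      then show ?thesis
      proof cases
        case 2
        then show ?thesis by (intro UnI2 UnI1 image_eqI[of _ _ "nat k"]) auto
      next
        case 3
        then show ?thesis by (intro UnI2 image_eqI[of _ _ "nat (- k)"]) auto
      qed auto
    qed
    then show ?thesis by blast
  qed
  finally show ?thesis by simp
qed

text \<open>With x = n^2 - 1, both n^2 and 2^(n-1) are at most exp x, and b/2 \<ge> 2 absorbs the
  product; one factor exp (- b/2) remains. The factors (1/2)^n sum to 1 over n \<ge> 1.\<close>

lemma square_times_weight_le:
  assumes b: "12 \<le> b" and n: "1 \<le> (n::nat)"
  shows "(real n)\<^sup>2 * exp (- (b / 2) * (real n)\<^sup>2) \<le> 2 * exp (- (b / 2)) * (1 / 2) ^ n"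
proof -
  let ?x = "(real n)\<^sup>2 - 1"
  have nx: "real n - 1 \<le> ?x" "0 \<le> ?x" using n self_le_power[of "real n" 2] by auto
  have 1: "(real n)\<^sup>2 \<le> exp ?x" using exp_ge_add_one_self[of ?x] by simp
  have "(2::real) ^ (n - 1) \<le> exp 1 ^ (n - 1)"
    using exp_ge_add_one_self[of 1] by (intro power_mono) auto
  also have "\<dots> = exp (real n - 1)" using n by (simp add: of_nat_diff flip: exp_of_nat_mult)
  also have "\<dots> \<le> exp ?x" using nx by simp
  finally have "(real n)\<^sup>2 * 2 ^ (n - 1) \<le> exp ?x * exp ?x" using 1 by (intro mult_mono) auto
  also have "\<dots> \<le> exp (b / 2 * ?x)"
    using mult_right_mono[of 2 "b / 2" ?x] b nx by (simp flip: exp_add)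
  finally have "(real n)\<^sup>2 * 2 ^ (n - 1) * exp (- (b / 2) * (real n)\<^sup>2)
      \<le> exp (b / 2 * ?x) * exp (- (b / 2) * (real n)\<^sup>2)"
    by (intro mult_right_mono) auto
  also have "\<dots> = exp (- (b / 2))" by (simp add: algebra_simps flip: exp_add)
  finally have *: "(real n)\<^sup>2 * 2 ^ (n - 1) * exp (- (b / 2) * (real n)\<^sup>2) \<le> exp (- (b / 2))" .
  have "2 ^ n = (2::real) * 2 ^ (n - 1)" using n by (cases n) auto
  then show ?thesis using * by (simp add: field_simps power_one_over)
qed

lemma Var_IG_nonneg: "0 \<le> Var_IG a b"
  unfolding Var_IG_def by (rule measure_pmf.variance_positive)

text \<open>The second moment bounds the variance, and the term k = 0 alone makes the normalisation
  at least 1. The constant 4 is the 2 of \<open>square_times_weight_le\<close>, doubled for the two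
  signs of k.\<close>

lemma Var_IG_0_le:
  assumes b: "12 \<le> b"
  shows "Var_IG 0 b \<le> 4 * exp (- (b / 2))"
proof -
  define w where "w = ig_weight b 0"
  define Z where "Z = infsum w UNIV"
  let ?e = "exp (- (b / 2))"
  have w0: "0 < w k" for k by (simp add: w_def ig_weight_pos)
  have ws: "w summable_on UNIV" unfolding w_def by (rule ig_weight_summable[OF b])
  have "infsum w {0} \<le> Z" unfolding Z_def
    using ws w0 by (intro infsum_mono_neutral) (auto simp: less_imp_le)
  then have Z: "1 \<le> Z" by (simp add: w_def ig_weight_def)
  have p: "pmf (integer_gaussian 0 b) k = w k / Z" for k
    unfolding integer_gaussian_def using pmf_gibbs_pmf[of w UNIV k] ws w0 Z
    by (simp add: Z_def w_def ig_weight_def[abs_def] less_imp_le)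
  \<comment> \<open>The value at 0 is set to 0 because the second moment has no contribution there
    and \<open>infsum_abs_int\<close> counts positive and negative k only.\<close>
  let ?g = "\<lambda>n. if n = 0 then 0 else 2 * ?e * (1 / 2) ^ n"
  have "(?g has_sum (2 * ?e * ((1/2) / (1 - 1/2)))) {1..}"
    using has_sum_cmult_right[OF has_sum_geometric_from_1[of "1/2"], of "2 * ?e"]
    by (subst has_sum_cong[of _ _ "\<lambda>n. 2 * ?e * (1 / 2) ^ n"]) auto
  from infsum_abs_int[OF this]
  have hs: "((\<lambda>k. ?g (nat \<bar>k\<bar>)) has_sum (4 * ?e)) (UNIV :: int set)" by simp
  have le: "(real_of_int k)\<^sup>2 * w k \<le> ?g (nat \<bar>k\<bar>)" for k
    using square_times_weight_le[OF b, of "nat \<bar>k\<bar>"] by (simp add: w_def ig_weight_def)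
  have nn: "0 \<le> (real_of_int k)\<^sup>2 * w k" for k using w0[of k] by simp
  have s2: "(\<lambda>k. (real_of_int k)\<^sup>2 * w k) summable_on UNIV"
    by (rule summable_on_comparison_test[OF has_sum_imp_summable[OF hs]]) (use le nn in auto)
  have i2: "infsum (\<lambda>k. (real_of_int k)\<^sup>2 * w k) UNIV \<le> 4 * ?e"
    unfolding infsumI[OF hs, symmetric]
    by (intro infsum_mono s2 has_sum_imp_summable[OF hs] le)
  let ?p = "integer_gaussian 0 b"
  have int: "integrable (measure_pmf ?p) f"
    if "\<And>k. \<bar>f k\<bar> \<le> (real_of_int k)\<^sup>2" for f :: "int \<Rightarrow> real"
  proof -
    have "(\<lambda>k. norm (pmf ?p k * f k)) summable_on UNIV"
    proof (rule summable_on_comparison_test[OF s2])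
      fix k
      have "\<bar>w k / Z * f k\<bar> \<le> w k * (real_of_int k)\<^sup>2"
        unfolding abs_mult using that[of k] w0[of k] Z
        by (intro mult_mono) (auto simp: field_simps)
      then show "norm (pmf ?p k * f k) \<le> (real_of_int k)\<^sup>2 * w k" by (simp add: p mult.commute)
    qed auto
    then have "Infinite_Set_Sum.abs_summable_on (\<lambda>k. pmf ?p k * f k) UNIV"
      by (simp only: abs_summable_equivalent)
    then show ?thesis
      unfolding measure_pmf_eq_density abs_summable_on_def
      by (subst integrable_density) auto
  qed
  have "\<bar>real_of_int k\<bar> \<le> (real_of_int k)\<^sup>2" for k
    using self_le_power[of "\<bar>real_of_int k\<bar>" 2] by (cases "k = 0") auto
  then have "Var_IG 0 b = measure_pmf.expectation ?p (\<lambda>k. (real_of_int k)\<^sup>2)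
      - (measure_pmf.expectation ?p real_of_int)\<^sup>2"
    unfolding Var_IG_def by (intro measure_pmf.variance_eq int) auto
  also have "\<dots> \<le> measure_pmf.expectation ?p (\<lambda>k. (real_of_int k)\<^sup>2)" by simp
  also have "\<dots> = infsetsum (\<lambda>k. pmf ?p k * (real_of_int k)\<^sup>2) UNIV"
    by (rule pmf_expectation_eq_infsetsum)
  also have "\<dots> = infsum (\<lambda>k. pmf ?p k * (real_of_int k)\<^sup>2) UNIV"
  proof (rule infsetsum_infsum)
    have "integrable (measure_pmf ?p) (\<lambda>k. (real_of_int k)\<^sup>2)" by (rule int) simp
    then show "Infinite_Set_Sum.abs_summable_on (\<lambda>k. pmf ?p k * (real_of_int k)\<^sup>2) UNIV"
      unfolding measure_pmf_eq_density abs_summable_on_def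
      by (subst (asm) integrable_density) auto
  qed
  also have "\<dots> = infsum (\<lambda>k. (1 / Z) * ((real_of_int k)\<^sup>2 * w k)) UNIV"
    by (simp add: p field_simps)
  also have "\<dots> = (1 / Z) * infsum (\<lambda>k. (real_of_int k)\<^sup>2 * w k) UNIV"
    by (rule infsum_cmult_right')
  also have "\<dots> \<le> 1 * infsum (\<lambda>k. (real_of_int k)\<^sup>2 * w k) UNIV"
    using Z nn by (intro mult_right_mono infsum_nonneg) auto
  finally show ?thesis using i2 by simp
qed

text \<open>The infimum over centres is at most the value at centre 0, and the prefactor of
  \<open>M_err\<close> cancels. Half of the bound, exp (- b/2), is exactly the rate obtained from
  the characteristic functions.\<close>

lemma M_err_le:
  assumes "1 / 3 \<le> \<beta>"
  shows "M_err \<beta> / (2 * (2 * pi)\<^sup>2 * \<beta>) \<le> 2 * exp (- ((2 * pi)\<^sup>2 * \<beta> / 2))"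
    and "12 \<le> (2 * pi)\<^sup>2 * \<beta>"
proof -
  let ?b = "(2 * pi)\<^sup>2 * \<beta>"
  have "3 * 3 \<le> pi * pi" using pi_gt3 by (intro mult_mono) auto
  then have "36 \<le> (2 * pi)\<^sup>2" by (simp add: power2_eq_square)
  then have "36 * (1 / 3) \<le> ?b" using assms by (intro mult_mono) auto
  then show b: "12 \<le> ?b" by simp
  have "(INF a\<in>{0..1/2}. Var_IG a ?b) \<le> Var_IG 0 ?b"
    by (intro cINF_lower bdd_belowI2[of _ 0]) (auto intro: Var_IG_nonneg)
  also have "\<dots> \<le> 4 * exp (- (?b / 2))" by (rule Var_IG_0_le[OF b])
  finally have "(INF a\<in>{0..1/2}. Var_IG a ?b) \<le> 4 * exp (- (?b / 2))" .
  moreover have "M_err \<beta> / (2 * (2 * pi)\<^sup>2 * \<beta>) = (INF a\<in>{0..1/2}. Var_IG a ?b) / 2"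
    unfolding M_err_def using b assms by simp
  ultimately show "M_err \<beta> / (2 * (2 * pi)\<^sup>2 * \<beta>) \<le> 2 * exp (- (?b / 2))" by linarith
qed

section \<open>Forms on the dual graph\<close>

text \<open>Connectedness is stated as an induction principle over face sets closed under crossing
  edges. This avoids walks, is easy to check row by row on a grid, and yields both uniqueness of
  potentials and a spanning tree.\<close>

locale rooted_face_graph =
  fixes G :: "('v, 'e, 'f) embedded_graph"
  assumes finite_edges: "finite (edges G)"
    and finite_faces: "finite (faces G)"
    and adjacent_faces: "\<And>e. e \<in> edges G \<Longrightarrow> left_face G e \<in> faces G \<and> right_face G e \<in> faces G"
    and marked: "marked_face G \<in> faces G"
    and connected: "\<And>A. marked_face G \<in> A \<Longrightarrow>
      (\<And>e. e \<in> edges G \<Longrightarrow> left_face G e \<in> A \<longleftrightarrow> right_face G e \<in> A) \<Longrightarrow> faces G \<subseteq> A"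
begin

abbreviation "E \<equiv> edges G"
abbreviation "F \<equiv> faces G - {marked_face G}"
abbreviation "lf \<equiv> left_face G"
abbreviation "rf \<equiv> right_face G"
abbreviation "root_face \<equiv> marked_face G"

lemma finite_F: "finite F"
  using finite_faces by simp

text \<open>The incidence matrix of the dual graph with the column of the marked face deleted; an
  edge with the same face on both sides gets 0.\<close>

definition inc :: "'e \<Rightarrow> 'f \<Rightarrow> int" where
  "inc e f = (if f \<in> F then of_bool (lf e = f) - of_bool (rf e = f) else 0)"

definition grad :: "('f \<Rightarrow> real) \<Rightarrow> 'e \<Rightarrow> real" where
  "grad h e = h (lf e) - h (rf e)"

definition dvg :: "('e \<Rightarrow> 'a::comm_ring_1) \<Rightarrow> 'f \<Rightarrow> 'a" where
  "dvg m f = (\<Sum>e\<in>E. of_int (inc e f) * m e)"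

lemma dvg_outside: "f \<notin> F \<Longrightarrow> dvg m f = 0"
  unfolding dvg_def inc_def by (intro sum.neutral) auto

lemma dvg_two_form: "dvg m \<in> two_forms G"
  by (auto simp: two_forms_def dvg_outside)

lemma sum_inc:
  fixes h :: "'f \<Rightarrow> 'a::comm_ring_1"
  assumes "e \<in> E" "h root_face = 0"
  shows "(\<Sum>f\<in>F. of_int (inc e f) * h f) = h (lf e) - h (rf e)"
proof -
  have *: "(\<Sum>f\<in>F. of_bool (x = f) * h f) = h x" if "x \<in> faces G" for x
    using that assms(2) finite_F by (auto simp: of_bool_def if_distrib[of "\<lambda>c. c * _"] cong: if_cong)
  have "(\<Sum>f\<in>F. of_int (inc e f) * h f) = (\<Sum>f\<in>F. of_bool (lf e = f) * h f - of_bool (rf e = f) * h f)"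
    by (intro sum.cong) (auto simp: inc_def)
  then show ?thesis using adjacent_faces[OF assms(1)] * by (simp add: sum_subtractf)
qed

text \<open>Summation by parts; the vanishing of \<open>h\<close> at the root makes up for the
  deleted column.\<close>

lemma sum_mult_dvg:
  fixes h :: "'f \<Rightarrow> 'a::comm_ring_1"
  assumes "h root_face = 0"
  shows "(\<Sum>f\<in>F. h f * dvg m f) = (\<Sum>e\<in>E. (h (lf e) - h (rf e)) * m e)"
proof -
  have "(\<Sum>f\<in>F. h f * dvg m f) = (\<Sum>f\<in>F. \<Sum>e\<in>E. (of_int (inc e f) * h f) * m e)"
    by (simp add: dvg_def sum_distrib_left mult_ac)
  also have "\<dots> = (\<Sum>e\<in>E. (\<Sum>f\<in>F. of_int (inc e f) * h f) * m e)"
    by (subst sum.swap) (simp add: sum_distrib_right)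
  also have "\<dots> = (\<Sum>e\<in>E. (h (lf e) - h (rf e)) * m e)"
    using assms by (intro sum.cong refl) (simp add: sum_inc)
  finally show ?thesis .
qed

lemma form_inner_dvg:
  assumes "h \<in> two_forms G"
  shows "form_inner G h (dvg m) = (\<Sum>e\<in>E. grad h e * m e)"
proof -
  have "form_inner G h (dvg m) = (\<Sum>f\<in>F. h f * dvg m f)"
    unfolding form_inner_def using finite_faces dvg_outside
    by (intro sum.mono_neutral_right) auto
  then show ?thesis using assms sum_mult_dvg[of h m] by (simp add: two_forms_def grad_def)
qed

lemma neg_laplacian_eq: "(\<lambda>f. - laplacian G h f) = dvg (grad h)"
proof
  fix f
  show "- laplacian G h f = dvg (grad h) f"
  proof (cases "f \<in> F")
    case True
    have "dvg (grad h) f = (\<Sum>e\<in>E. (if lf e = f then grad h e else 0) - (if rf e = f then grad h e else 0))"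
      unfolding dvg_def using True by (intro sum.cong) (auto simp: inc_def)
    also have "\<dots> = (\<Sum>e\<in>{e \<in> E. lf e = f}. grad h e) - (\<Sum>e\<in>{e \<in> E. rf e = f}. grad h e)"
      unfolding sum_subtractf using finite_edges by (simp add: sum.If_cases Int_def)
    also have "(\<Sum>e\<in>{e \<in> E. lf e = f}. grad h e) = - (\<Sum>e\<in>{e \<in> E. lf e = f}. h (rf e) - h f)"
      unfolding sum_negf[symmetric] by (intro sum.cong) (auto simp: grad_def)
    also have "(\<Sum>e\<in>{e \<in> E. rf e = f}. grad h e) = (\<Sum>e\<in>{e \<in> E. rf e = f}. h (lf e) - h f)"
      by (intro sum.cong) (auto simp: grad_def)
    finally show ?thesis using True by (simp add: laplacian_def to_two_form_def)
  next
    case False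
    then show ?thesis by (auto simp: dvg_outside laplacian_def to_two_form_def)
  qed
qed

section \<open>Invertibility of the Laplacian\<close>

lemma grad_eq_0_imp:
  assumes h: "h \<in> two_forms G" and 0: "\<And>e. e \<in> E \<Longrightarrow> grad h e = 0"
  shows "h = (\<lambda>_. 0)"
proof -
  have "faces G \<subseteq> {f. h f = 0}"
    using h 0 by (intro connected) (auto simp: two_forms_def grad_def)
  then show ?thesis using h by (auto simp: two_forms_def fun_eq_iff)
qed

lemma energy_eq_0_imp:
  assumes h: "h \<in> two_forms G" and 0: "(\<Sum>f\<in>F. h f * dvg (grad h) f) = 0"
  shows "h = (\<lambda>_. 0)"
proof (rule grad_eq_0_imp[OF h])
  fix e assume e: "e \<in> E"
  have "(\<Sum>e\<in>E. grad h e * grad h e) = 0"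
    using 0 sum_mult_dvg[of h "grad h"] h by (simp add: two_forms_def flip: grad_def)
  then show "grad h e = 0"
    using e finite_edges by (subst (asm) sum_nonneg_eq_0_iff) auto
qed

lemma dvg_grad_linear:
  "dvg (grad (\<lambda>f. g f + c * h f)) = (\<lambda>f. dvg (grad g) f + c * dvg (grad h) f)"
  by (simp add: dvg_def grad_def fun_eq_iff sum_distrib_left algebra_simps flip: sum.distrib)

text \<open>A Gaussian elimination: the energy is positive definite, so every pivot is nonzero.\<close>

lemma dvg_grad_solvable_on:
  assumes "finite I" "I \<subseteq> F"
  shows "\<exists>g. (\<forall>f. f \<notin> I \<longrightarrow> g f = 0) \<and> (\<forall>f\<in>I. dvg (grad g) f = b f)"
  using assms
proof (induction I arbitrary: b rule: finite_induct)
  case empty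
  then show ?case by (intro exI[of _ "\<lambda>_. 0"]) simp
next
  case (insert i I)
  let ?A = "\<lambda>g. dvg (grad g)"
  let ?d = "\<lambda>f. of_bool (f = i) :: real"
  obtain y where y: "\<forall>f. f \<notin> I \<longrightarrow> y f = 0" "\<forall>f\<in>I. ?A y f = - ?A ?d f"
    using insert.IH[of "\<lambda>f. - ?A ?d f"] insert.prems by blast
  \<comment> \<open>\<open>v\<close> equals 1 at \<open>i\<close>, vanishes outside
    \<open>insert i I\<close> and is harmonic on \<open>I\<close>. Its energy is therefore
    \<open>?A v i\<close>, the pivot.\<close>
  define v where "v = (\<lambda>f. y f + 1 * ?d f)"
  have Av: "?A v f = 0" if "f \<in> I" for f
    unfolding v_def dvg_grad_linear using y(2) that by simp
  have v0: "v f = 0" if "f \<notin> insert i I" for f using that y(1) by (auto simp: v_def)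
  have vi: "v i = 1" using y(1) insert.hyps by (simp add: v_def)
  have vt: "v \<in> two_forms G" using v0 insert.prems unfolding two_forms_def by blast
  have "?A v i \<noteq> 0"
  proof
    assume "?A v i = 0"
    then have "(\<Sum>f\<in>F. v f * ?A v f) = 0"
      using Av v0 by (intro sum.neutral) (metis insertE mult_eq_0_iff)
    from energy_eq_0_imp[OF vt this] vi show False by simp
  qed
  obtain x where x: "\<forall>f. f \<notin> I \<longrightarrow> x f = 0" "\<forall>f\<in>I. ?A x f = b f"
    using insert.IH[of b] insert.prems by blast
  define c where "c = (b i - ?A x i) / ?A v i"
  show ?case
  proof (intro exI[of _ "\<lambda>f. x f + c * v f"] conjI allI impI ballI)
    show "x f + c * v f = 0" if "f \<notin> insert i I" for f
      using that x(1) v0[OF that] by simp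
    show "?A (\<lambda>f. x f + c * v f) f = b f" if "f \<in> insert i I" for f
      unfolding dvg_grad_linear using that x(2) Av \<open>?A v i \<noteq> 0\<close> by (auto simp: c_def)
  qed
qed

lemma dvg_grad_inj: "inj_on (\<lambda>g. dvg (grad g)) (two_forms G)"
proof (rule inj_onI)
  fix g h assume gh: "g \<in> two_forms G" "h \<in> two_forms G" and eq: "dvg (grad g) = dvg (grad h)"
  have "(\<lambda>f. g f + (-1) * h f) = (\<lambda>_. 0)"
  proof (rule energy_eq_0_imp)
    show "(\<lambda>f. g f + (-1) * h f) \<in> two_forms G" using gh by (simp add: two_forms_def)
    show "(\<Sum>f\<in>F. (g f + (-1) * h f) * dvg (grad (\<lambda>f. g f + (-1) * h f)) f) = 0"
      unfolding dvg_grad_linear eq by simp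
  qed
  then show "g = h" by (auto simp: fun_eq_iff)
qed

lemma dvg_grad_surj: "u \<in> two_forms G \<Longrightarrow> u \<in> (\<lambda>g. dvg (grad g)) ` two_forms G"
proof -
  assume u: "u \<in> two_forms G"
  obtain g where g: "\<forall>f. f \<notin> F \<longrightarrow> g f = 0" "\<forall>f\<in>F. dvg (grad g) f = u f"
    using dvg_grad_solvable_on[OF finite_F order_refl, of u] by blast
  have "dvg (grad g) = u"
    using g(2) u dvg_outside by (fastforce simp: two_forms_def fun_eq_iff)
  moreover have "g \<in> two_forms G" using g(1) by (auto simp: two_forms_def)
  ultimately show ?thesis by blast
qed

lemma to_two_form_in: "to_two_form G u \<in> two_forms G"
  by (auto simp: to_two_form_def two_forms_def)

lemma to_two_form_id: "u \<in> two_forms G \<Longrightarrow> to_two_form G u = u"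
  by (auto simp: to_two_form_def two_forms_def fun_eq_iff)

lemma inv_neg_laplacian_in: "inv_neg_laplacian G u \<in> two_forms G"
  and dvg_grad_inv_neg_laplacian: "dvg (grad (inv_neg_laplacian G u)) = to_two_form G u"
  unfolding inv_neg_laplacian_def neg_laplacian_eq
  using inv_into_into[OF dvg_grad_surj[OF to_two_form_in]]
    f_inv_into_f[OF dvg_grad_surj[OF to_two_form_in]] by auto

lemma inv_neg_laplacian_unique:
  assumes "g \<in> two_forms G" "dvg (grad g) = to_two_form G u"
  shows "inv_neg_laplacian G u = g"
  using inj_onD[OF dvg_grad_inj] assms inv_neg_laplacian_in dvg_grad_inv_neg_laplacian by simp

lemma inv_laplacian_eq: "inv_laplacian G u = (\<lambda>f. - inv_neg_laplacian G u f)"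
proof -
  have L: "laplacian G h = (\<lambda>f. - dvg (grad h) f)" for h
    unfolding neg_laplacian_eq[symmetric] by simp
  have neg: "dvg (grad (\<lambda>f. - h f)) = (\<lambda>f. - dvg (grad h) f)" for h
    using dvg_grad_linear[of "\<lambda>_. 0" "-1" h] by (simp add: dvg_def grad_def)
  have inj: "inj_on (laplacian G) (two_forms G)"
    using dvg_grad_inj by (auto simp: inj_on_def L fun_eq_iff)
  let ?g = "\<lambda>f. - inv_neg_laplacian G u f"
  have "?g \<in> two_forms G" using inv_neg_laplacian_in[of u] by (simp add: two_forms_def)
  moreover have "laplacian G ?g = to_two_form G u"
    by (simp add: L neg dvg_grad_inv_neg_laplacian)
  ultimately show ?thesis
    unfolding inv_laplacian_def using inj by (metis inv_into_f_f)
qed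

lemma form_inner_inv_neg_laplacian:
  "form_inner G u (inv_neg_laplacian G u) = (\<Sum>e\<in>E. (grad (inv_neg_laplacian G u) e)\<^sup>2)"
proof -
  let ?h = "inv_neg_laplacian G u"
  have "form_inner G u ?h = form_inner G ?h (to_two_form G u)"
    unfolding form_inner_def using inv_neg_laplacian_in[of u]
    by (intro sum.cong) (auto simp: to_two_form_def two_forms_def)
  then show ?thesis
    using form_inner_dvg[OF inv_neg_laplacian_in, of u "grad ?h"]
    by (simp add: dvg_grad_inv_neg_laplacian power2_eq_square)
qed

section \<open>The potential of a dipole\<close>

definition dipole :: "'f \<Rightarrow> 'f \<Rightarrow> 'f \<Rightarrow> real" where
  "dipole f f' = (\<lambda>x. indicator {f} x - indicator {f'} x)"

abbreviation "potential f f' \<equiv> inv_neg_laplacian G (dipole f f')"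

lemma form_inner_dipole:
  assumes h: "h root_face = 0" and f: "f \<in> faces G" "f' \<in> faces G"
  shows "form_inner G h (to_two_form G (dipole f f')) = h f - h f'"
proof -
  have *: "(\<Sum>x\<in>faces G. h x * indicator {a} x) = h a" if "a \<in> faces G" for a
    using that finite_faces by (simp add: indicator_def if_distrib cong: if_cong)
  have "form_inner G h (to_two_form G (dipole f f')) =
      (\<Sum>x\<in>faces G. h x * indicator {f} x - h x * indicator {f'} x)"
    unfolding form_inner_def using h
    by (intro sum.cong) (auto simp: to_two_form_def dipole_def right_diff_distrib)
  then show ?thesis using f by (simp add: sum_subtractf *)
qed

text \<open>Symmetry of the Green function moves the inverse Laplacian onto the dipole; a last
  summation by parts admits any \<open>m\<close> with the right divergence, not only a gradient. The
  observable thus becomes a sum of one term per edge.\<close>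

lemma inv_laplacian_difference:
  assumes f: "f \<in> faces G" "f' \<in> faces G" and m: "to_two_form G u = dvg m"
  shows "inv_laplacian G u f - inv_laplacian G u f' = - (\<Sum>e\<in>E. grad (potential f f') e * m e)"
proof -
  let ?g = "inv_neg_laplacian G u" and ?h = "potential f f'"
  have "?g f - ?g f' = form_inner G ?g (dvg (grad ?h))"
    unfolding dvg_grad_inv_neg_laplacian
    using form_inner_dipole f inv_neg_laplacian_in[of u] by (simp add: two_forms_def)
  also have "\<dots> = (\<Sum>e\<in>E. grad ?g e * grad ?h e)" by (rule form_inner_dvg[OF inv_neg_laplacian_in])
  also have "\<dots> = (\<Sum>e\<in>E. grad ?h e * grad ?g e)" by (simp add: mult.commute)
  also have "\<dots> = form_inner G ?h (dvg (grad ?g))"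
    by (rule form_inner_dvg[OF inv_neg_laplacian_in, symmetric])
  also have "\<dots> = (\<Sum>e\<in>E. grad ?h e * m e)"
    unfolding dvg_grad_inv_neg_laplacian m by (rule form_inner_dvg[OF inv_neg_laplacian_in])
  finally show ?thesis by (simp add: inv_laplacian_eq)
qed

text \<open>Truncating the potential to the interval between its values at the two ends of \<open>e\<close> and
  pairing with the unit current bounds the energy in that interval by its length; the detour
  \<open>D\<close> contributes at least a third of what \<open>e\<close> does.\<close>

lemma grad_potential_bound:
  assumes f: "f \<in> faces G" "f' \<in> faces G" and e: "e \<in> E"
    and D: "D \<subseteq> E - {e}" "card D \<le> 3" "\<And>g. \<bar>grad g e\<bar> \<le> (\<Sum>d\<in>D. \<bar>grad g d\<bar>)"
  shows "\<bar>grad (potential f f') e\<bar> \<le> 3 / 4"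
proof -
  define h where "h = potential f f'"
  define a b where "a = min (h (lf e)) (h (rf e))" and "b = max (h (lf e)) (h (rf e))"
  define L where "L = \<bar>grad h e\<bar>"
  have L: "L = b - a" "a \<le> b" by (auto simp: L_def a_def b_def grad_def)
  define g where "g x = max a (min b (h x))" for x
  \<comment> \<open>Subtracting the root value makes summation by parts applicable and leaves all
    gradients along edges unchanged.\<close>
  define g' where "g' x = (if x \<in> faces G then g x - g root_face else 0)" for x
  have g': "g' \<in> two_forms G" by (auto simp: g'_def two_forms_def)
  have gg': "grad g' d = grad g d" if "d \<in> E" for d
    using adjacent_faces[OF that] by (simp add: g'_def grad_def)
  have ge: "\<bar>grad g e\<bar> = L" by (auto simp: g_def a_def b_def L_def grad_def)
  \<comment> \<open>Truncation is monotone and 1-Lipschitz, so increments of \<open>g\<close> have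
    the sign of those of \<open>h\<close> and are no larger.\<close>
  have clamp: "(grad g d)\<^sup>2 \<le> grad g d * grad h d" for d
  proof -
    have *: "(max a (min b x) - max a (min b y))\<^sup>2 \<le> (max a (min b x) - max a (min b y)) * (x - y)"
      for x y :: real
    proof -
      let ?u = "max a (min b x) - max a (min b y)"
      have "0 \<le> ?u * ((x - y) - ?u)"
        unfolding zero_le_mult_iff using L(2) by (simp add: max_def min_def) argo
      then show ?thesis by (simp add: power2_eq_square algebra_simps)
    qed
    show ?thesis unfolding grad_def g_def by (rule *)
  qed
  have fin: "finite D" using D(1) finite_edges finite_subset by blast
  \<comment> \<open>Cauchy-Schwarz on at most three edges gives the detour energy at least L^2 / 3.
    Together with \<open>e\<close> itself, 4/3 L^2 \<le> L, which is the origin of 3/4.\<close>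
  have "L\<^sup>2 \<le> (\<Sum>d\<in>D. \<bar>grad g d\<bar>)\<^sup>2"
    using D(3)[of g] ge by (intro power_mono) (auto simp: L_def)
  also have "\<dots> \<le> (\<Sum>d\<in>D. \<bar>grad g d\<bar>\<^sup>2) * real (card D)"
    by (rule sum_squared_le_sum_of_squares)
  also have "\<dots> \<le> (\<Sum>d\<in>D. \<bar>grad g d\<bar>\<^sup>2) * 3"
    using D(2) by (intro mult_left_mono sum_nonneg) auto
  finally have "4 / 3 * L\<^sup>2 \<le> L\<^sup>2 + (\<Sum>d\<in>D. (grad g d)\<^sup>2)" by simp
  also have "\<dots> = (\<Sum>d\<in>insert e D. (grad g d)\<^sup>2)"
    using D(1) fin ge by (subst sum.insert) (auto simp flip: ge)
  also have "\<dots> \<le> (\<Sum>d\<in>E. (grad g d)\<^sup>2)"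
    using D(1) e finite_edges by (intro sum_mono2) auto
  also have "\<dots> \<le> (\<Sum>d\<in>E. grad g' d * grad h d)"
    using clamp gg' by (intro sum_mono) auto
  also have "\<dots> = form_inner G g' (dvg (grad h))" by (rule form_inner_dvg[OF g', symmetric])
  also have "\<dots> = g' f - g' f'"
    unfolding h_def dvg_grad_inv_neg_laplacian
    by (rule form_inner_dipole) (use g' f in \<open>auto simp: two_forms_def\<close>)
  also have "\<dots> \<le> L" using f L by (auto simp: g'_def g_def)
  finally have "L * L * 4 \<le> L * 3" by (simp add: power2_eq_square)
  moreover have "0 \<le> L" by (simp add: L_def)
  ultimately have "L \<le> 3 / 4" by (cases "L = 0") (auto simp: mult.assoc)
  then show ?thesis by (simp add: L_def h_def)
qed

text \<open>\<open>\<pi> v\<close> is the signed indicator of the tree path between the root and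
  \<open>v\<close>, as a current with divergence 1 at \<open>v\<close>. The last clause encodes
  acyclicity: the paths to the two ends of a tree edge differ by exactly that edge. Trees on a
  partial face set \<open>A\<close> are included so that a tree can be grown.\<close>

definition rooted_tree :: "'f set \<Rightarrow> 'e set \<Rightarrow> ('f \<Rightarrow> 'e \<Rightarrow> int) \<Rightarrow> bool" where
  "rooted_tree A T \<pi> \<longleftrightarrow> root_face \<in> A \<and> A \<subseteq> faces G \<and> T \<subseteq> E \<and> (\<forall>e\<in>T. lf e \<in> A \<and> rf e \<in> A) \<and>
    (\<forall>v e. e \<notin> T \<longrightarrow> \<pi> v e = 0) \<and> \<pi> root_face = (\<lambda>_. 0) \<and>
    (\<forall>v\<in>A. \<forall>f\<in>F. dvg (\<pi> v) f = of_bool (f = v)) \<and>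
    (\<forall>e\<in>T. \<forall>a. \<pi> (lf e) a - \<pi> (rf e) a = of_bool (a = e))"

lemma dvg_unit: "e \<in> E \<Longrightarrow> dvg (\<lambda>a. of_bool (a = e)) f = of_int (inc e f)"
  using finite_edges by (simp add: dvg_def)

lemma dvg_add: "dvg (\<lambda>e. m e + c * m' e) f = dvg m f + c * dvg m' f"
  by (simp add: dvg_def sum_distrib_left algebra_simps flip: sum.distrib)

text \<open>A new leaf \<open>w\<close> is attached through \<open>e\<close>; the sign
  \<open>s\<close> records on which side of \<open>e\<close> the leaf lies.\<close>

lemma rooted_tree_extend:
  assumes tree: "rooted_tree A T \<pi>" and e: "e \<in> E" and uw: "u \<in> A" "w \<notin> A"
    and or: "lf e = w \<and> rf e = u \<and> s = 1 \<or> lf e = u \<and> rf e = w \<and> s = - 1"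
  shows "rooted_tree (insert w A) (insert e T) (\<pi>(w := \<lambda>a. \<pi> u a + s * of_bool (a = e)))"
proof -
  note t = tree[unfolded rooted_tree_def]
  have eT: "e \<notin> T" using t uw or by metis
  have w: "w \<in> faces G" "w \<noteq> root_face" using adjacent_faces[OF e] or t uw by auto
  have "dvg (\<lambda>a. \<pi> u a + s * of_bool (a = e)) f = of_bool (f = w)" if "f \<in> F" for f
    using or t that uw unfolding dvg_add dvg_unit[OF e] by (auto simp: inc_def)
  moreover have "\<pi> u e = 0" using eT t by blast
  ultimately show ?thesis
    unfolding rooted_tree_def using t e eT w uw or by (auto; metis)
qed

text \<open>A maximal face set that carries a tree is closed under crossing edges, since otherwise a
  leaf could be attached; connectedness then makes it everything.\<close>

lemma spanning_tree: "\<exists>T \<pi>. rooted_tree (faces G) T \<pi>"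
proof -
  let ?X = "{A. \<exists>T \<pi>. rooted_tree A T \<pi>}"
  have "?X \<subseteq> Pow (faces G)" by (auto simp: rooted_tree_def)
  then have "finite ?X" using finite_faces finite_subset by blast
  moreover have "rooted_tree {root_face} {} (\<lambda>_ _. 0)"
    using marked by (auto simp: rooted_tree_def dvg_def)
  then have "?X \<noteq> {}" by blast
  ultimately have "\<exists>A\<in>?X. \<forall>B\<in>?X. A \<subseteq> B \<longrightarrow> A = B"
    by (rule finite_has_maximal)
  then obtain A where "A \<in> ?X" and max: "\<And>B. B \<in> ?X \<Longrightarrow> A \<subseteq> B \<Longrightarrow> A = B"
    by auto
  then obtain T \<pi> where tree: "rooted_tree A T \<pi>" by blast
  have "faces G \<subseteq> A"
  proof (rule connected)
    show "root_face \<in> A" using tree by (simp add: rooted_tree_def)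
    fix e assume e: "e \<in> E"
    have False if "u \<in> A" "w \<notin> A"
      "lf e = w \<and> rf e = u \<and> s = 1 \<or> lf e = u \<and> rf e = w \<and> s = - 1" for u w and s :: int
    proof -
      have "insert w A \<in> ?X" using rooted_tree_extend[OF tree e that] by auto
      from max[OF this] that(2) show False by blast
    qed
    then show "lf e \<in> A \<longleftrightarrow> rf e \<in> A" by blast
  qed
  moreover have "A \<subseteq> faces G" using tree by (simp add: rooted_tree_def)
  ultimately show ?thesis using tree by auto
qed

end


section \<open>Integral coordinates from a spanning tree\<close>

locale face_graph_with_tree = rooted_face_graph G for G :: "('v, 'e, 'f) embedded_graph" +
  fixes T :: "'e set" and \<pi> :: "'f \<Rightarrow> 'e \<Rightarrow> int"
  assumes tree: "rooted_tree (faces G) T \<pi>"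
begin

definition "S = E - T"

text \<open>The fundamental cycle of a non-tree edge: the edge itself, closed up through the
  tree.\<close>

definition cycle :: "'e \<Rightarrow> 'e \<Rightarrow> int" where
  "cycle s e = of_bool (e = s) - (\<pi> (lf s) e - \<pi> (rf s) e)"

definition kernel_form :: "('e \<Rightarrow> 'a::comm_ring_1) \<Rightarrow> 'e \<Rightarrow> 'a" where
  "kernel_form \<theta> e = (\<Sum>s\<in>S. of_int (cycle s e) * \<theta> s)"

text \<open>A right inverse of the divergence on 2-forms, supported on the tree: each charge is
  routed along its path to the root.\<close>

definition lift_form :: "('f \<Rightarrow> 'a::comm_ring_1) \<Rightarrow> 'e \<Rightarrow> 'a" where
  "lift_form q e = (\<Sum>v\<in>F. of_int (\<pi> v e) * q v)"

lemma finite_S: "finite S"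
  using finite_edges by (simp add: S_def)

lemma path_root_face: "\<pi> root_face = (\<lambda>_. 0)"
  and path_outside: "e \<notin> T \<Longrightarrow> \<pi> v e = 0"
  and dvg_path: "v \<in> faces G \<Longrightarrow> f \<in> F \<Longrightarrow> dvg (\<pi> v) f = of_bool (f = v)"
  and path_tree_edge: "e \<in> T \<Longrightarrow> \<pi> (lf e) a - \<pi> (rf e) a = of_bool (a = e)"
  using tree by (auto simp: rooted_tree_def)

lemma T_subset: "T \<subseteq> E"
  using tree by (auto simp: rooted_tree_def)

lemma cycle_tree: "s \<in> T \<Longrightarrow> cycle s e = 0"
  by (simp add: cycle_def path_tree_edge)

lemma dvg_cycle:
  assumes "s \<in> E" shows "dvg (cycle s) f = 0"
proof (cases "f \<in> F")
  case True
  have "dvg (cycle s) f = dvg (\<lambda>a. of_bool (a = s)) f - (dvg (\<pi> (lf s)) f - dvg (\<pi> (rf s)) f)"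
    by (simp add: dvg_def cycle_def right_diff_distrib sum_subtractf)
  also have "\<dots> = 0"
    using adjacent_faces[OF assms] True by (simp add: dvg_unit[OF assms] dvg_path inc_def eq_commute)
  finally show ?thesis .
qed (rule dvg_outside)

lemma dvg_kernel_form: "dvg (kernel_form \<theta>) f = 0"
proof -
  have "dvg (kernel_form \<theta>) f = (\<Sum>s\<in>S. of_int (dvg (cycle s) f) * \<theta> s)"
    unfolding dvg_def kernel_form_def sum_distrib_left
    by (subst sum.swap) (simp add: sum_distrib_left sum_distrib_right mult_ac)
  also have "\<dots> = 0" by (intro sum.neutral) (auto simp: dvg_cycle S_def)
  finally show ?thesis .
qed

lemma kernel_form_nontree: "e \<in> S \<Longrightarrow> kernel_form \<theta> e = \<theta> e"
proof -
  assume e: "e \<in> S"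
  have "kernel_form \<theta> e = (\<Sum>s\<in>S. if e = s then \<theta> s else 0)"
    unfolding kernel_form_def using e
    by (intro sum.cong) (auto simp: cycle_def path_outside S_def)
  then show ?thesis using e finite_S by simp
qed

lemma lift_form_nontree: "e \<in> S \<Longrightarrow> lift_form q e = 0"
  by (simp add: lift_form_def path_outside S_def)

lemma dvg_lift_form:
  assumes "q \<in> two_forms G"
  shows "dvg (lift_form q) = q"
proof
  fix f
  show "dvg (lift_form q) f = q f"
  proof (cases "f \<in> F")
    case True
    have "dvg (lift_form q) f = (\<Sum>v\<in>F. of_int (dvg (\<pi> v) f) * q v)"
      unfolding dvg_def lift_form_def sum_distrib_left
      by (subst sum.swap) (simp add: sum_distrib_left sum_distrib_right mult_ac)
    also have "\<dots> = (\<Sum>v\<in>F. if f = v then q v else 0)"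
      using True by (intro sum.cong) (auto simp: dvg_path)
    also have "\<dots> = q f" using True finite_F by simp
    finally show ?thesis .
  next
    case False
    then show ?thesis using assms by (auto simp: dvg_outside two_forms_def)
  qed
qed

text \<open>All coefficients are integers, so this holds over the integers as well as over the
  reals. Hence the integer divergence-free forms are exactly the integer points in the coordinates
  on \<open>S\<close>, and the unit cube is a fundamental domain.\<close>

lemma form_decomposition:
  assumes "e \<in> E"
  shows "m e = lift_form (dvg m) e + kernel_form m e"
proof -
  have "lift_form (dvg m) e = (\<Sum>a\<in>E. (of_int (\<pi> (lf a) e) - of_int (\<pi> (rf a) e)) * m a)"
    unfolding lift_form_def using sum_mult_dvg[of "\<lambda>v. of_int (\<pi> v e)" m] by (simp add: path_root_face)
  also have "\<dots> = (\<Sum>a\<in>E. (if e = a then m a else 0) - of_int (cycle a e) * m a)"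
    by (intro sum.cong) (auto simp: cycle_def algebra_simps)
  also have "\<dots> = m e - (\<Sum>a\<in>E. of_int (cycle a e) * m a)"
    using assms finite_edges by (simp add: sum_subtractf)
  also have "(\<Sum>a\<in>E. of_int (cycle a e) * m a) = kernel_form m e"
    unfolding kernel_form_def S_def using finite_edges
    by (intro sum.mono_neutral_right) (auto simp: cycle_tree)
  finally show ?thesis by simp
qed

lemma kernel_form_cong: "(\<And>e. e \<in> S \<Longrightarrow> \<theta> e = \<theta>' e) \<Longrightarrow> kernel_form \<theta> = kernel_form \<theta>'"
  by (simp add: kernel_form_def fun_eq_iff cong: sum.cong)

lemma kernel_form_add: "kernel_form (\<lambda>s. \<theta> s + \<theta>' s) e = kernel_form \<theta> e + kernel_form \<theta>' e"
  by (simp add: kernel_form_def distrib_left sum.distrib)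

lemma of_int_kernel_form: "of_int (kernel_form k e) = kernel_form (\<lambda>s. of_int (k s)) e"
  by (simp add: kernel_form_def)

lemma dvg_cong: "(\<And>e. e \<in> E \<Longrightarrow> m e = m' e) \<Longrightarrow> dvg m = dvg m'"
  by (simp add: dvg_def fun_eq_iff)

text \<open>Divergence and non-tree values determine an integer form and can be prescribed freely.
  Extensional function spaces remove the arbitrary values outside \<open>E\<close> and
  \<open>S\<close>.\<close>

lemma bij_lift_kernel:
  "bij_betw (\<lambda>(q, k). \<lambda>e\<in>E. lift_form q e + kernel_form k e)
    ((two_forms G :: ('f \<Rightarrow> int) set) \<times> (S \<rightarrow>\<^sub>E UNIV)) (E \<rightarrow>\<^sub>E UNIV)"
proof (rule bij_betw_byWitness[of _ "\<lambda>m. (dvg m, restrict m S)"])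
  let ?f = "\<lambda>(q :: 'f \<Rightarrow> int, k). \<lambda>e\<in>E. lift_form q e + kernel_form k e"
  have SE: "S \<subseteq> E" by (auto simp: S_def)
  have dvg_f: "dvg (?f (q, k)) = q" if "q \<in> two_forms G" for q :: "'f \<Rightarrow> int" and k
  proof -
    have "dvg (?f (q, k)) = dvg (\<lambda>e. lift_form q e + 1 * kernel_form k e)"
      by (rule dvg_cong) simp
    then show ?thesis
      by (simp only: dvg_add fun_eq_iff dvg_lift_form[OF that] dvg_kernel_form) simp
  qed
  have "restrict (?f (q, k)) S = k" if "k \<in> S \<rightarrow>\<^sub>E UNIV" for q :: "'f \<Rightarrow> int" and k
    using that SE
    by (auto simp: fun_eq_iff lift_form_nontree kernel_form_nontree PiE_def extensional_def)
  then show "\<forall>a\<in>two_forms G \<times> (S \<rightarrow>\<^sub>E UNIV). (dvg (?f a), restrict (?f a) S) = a"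
    using dvg_f by auto
  show "\<forall>m\<in>E \<rightarrow>\<^sub>E UNIV. ?f (dvg m, restrict m S) = m"
  proof
    fix m :: "'e \<Rightarrow> int" assume m: "m \<in> E \<rightarrow>\<^sub>E UNIV"
    have "kernel_form (restrict m S) = kernel_form m" by (rule kernel_form_cong) simp
    then show "?f (dvg m, restrict m S) = m"
      using m form_decomposition[of _ m]
      by (auto simp: fun_eq_iff PiE_def extensional_def restrict_def)
  qed
  show "?f ` (two_forms G \<times> (S \<rightarrow>\<^sub>E UNIV)) \<subseteq> E \<rightarrow>\<^sub>E UNIV" by auto
  show "(\<lambda>m. (dvg m, restrict m S)) ` (E \<rightarrow>\<^sub>E UNIV) \<subseteq> two_forms G \<times> (S \<rightarrow>\<^sub>E UNIV)"
    using dvg_two_form by auto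
qed

end

section \<open>Sums and integrals over lattices\<close>

interpretation lborel_product: product_sigma_finite "\<lambda>_. lborel :: real measure"
  by (simp add: lborel.sigma_finite_measure_axioms product_sigma_finite.intro)

abbreviation lebesgue_on_pi :: "'i set \<Rightarrow> ('i \<Rightarrow> real) measure" where
  "lebesgue_on_pi I \<equiv> Pi\<^sub>M I (\<lambda>_. lborel)"

section \<open>Translating and unfolding Lebesgue measure on a finite product\<close>

lemma measurable_pi_translate:
  "(\<lambda>x. \<lambda>i\<in>I. x i + c i) \<in> measurable (lebesgue_on_pi I) (lebesgue_on_pi I)"
  by (intro measurable_restrict) simp

lemma nn_integral_pi_translate:
  fixes f :: "('i \<Rightarrow> real) \<Rightarrow> ennreal"
  assumes "finite I" "f \<in> borel_measurable (lebesgue_on_pi I)"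
  shows "(\<integral>\<^sup>+x. f (\<lambda>i\<in>I. x i + c i) \<partial>lebesgue_on_pi I) = (\<integral>\<^sup>+x. f x \<partial>lebesgue_on_pi I)"
  using assms
proof (induction I arbitrary: f rule: finite_induct)
  case empty
  show ?case
    by (subst (1 2) lborel_product.nn_integral_empty) (auto simp: restrict_def)
next
  case (insert i I)
  note [measurable] = insert.prems
  define H where "H x = (\<integral>\<^sup>+y. f (x(i := y)) \<partial>lborel)" for x
  have H[measurable]: "H \<in> borel_measurable (lebesgue_on_pi I)"
    unfolding H_def using insert.hyps by measurable
  have t[measurable]: "(\<lambda>x. f (\<lambda>j\<in>insert i I. x j + c j)) \<in> borel_measurable (lebesgue_on_pi (insert i I))"
    by (rule measurable_compose[OF measurable_pi_translate insert.prems])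
  have "(\<integral>\<^sup>+x. f (\<lambda>j\<in>insert i I. x j + c j) \<partial>lebesgue_on_pi (insert i I)) =
      (\<integral>\<^sup>+x. \<integral>\<^sup>+y. f (\<lambda>j\<in>insert i I. (x(i := y)) j + c j) \<partial>lborel \<partial>lebesgue_on_pi I)"
    using insert.hyps by (intro lborel_product.product_nn_integral_insert t) auto
  also have "\<dots> = (\<integral>\<^sup>+x. H (\<lambda>j\<in>I. x j + c j) \<partial>lebesgue_on_pi I)"
  proof (rule nn_integral_cong)
    fix x :: "'i \<Rightarrow> real" assume x: "x \<in> space (lebesgue_on_pi I)"
    let ?x = "\<lambda>j\<in>I. x j + c j"
    have "?x \<in> space (lebesgue_on_pi I)" by (simp add: space_PiM)
    then have "(\<lambda>y. ?x(i := y)) \<in> measurable lborel (lebesgue_on_pi (insert i I))"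
      using measurable_component_update[of ?x I "\<lambda>_. lborel" i] insert.hyps(2) by blast
    from measurable_compose[OF this insert.prems]
    have m: "(\<lambda>y. f (?x(i := y))) \<in> borel_measurable borel"
      by (simp only: measurable_lborel1 measurable_lborel2)
    have eq: "(\<lambda>j\<in>insert i I. (x(i := y)) j + c j) = ?x(i := c i + 1 * y)" for y
      using insert.hyps by (auto simp: fun_eq_iff)
    show "(\<integral>\<^sup>+y. f (\<lambda>j\<in>insert i I. (x(i := y)) j + c j) \<partial>lborel) = H ?x"
      unfolding eq H_def
      by (subst nn_integral_real_affine[OF m, of 1 "c i"]) (simp_all only: abs_one ennreal_1 mult_1)
  qed
  also have "\<dots> = (\<integral>\<^sup>+x. H x \<partial>lebesgue_on_pi I)" by (rule insert.IH[OF H])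
  also have "\<dots> = (\<integral>\<^sup>+x. f x \<partial>lebesgue_on_pi (insert i I))"
    unfolding H_def using insert.hyps by (intro lborel_product.product_nn_integral_insert[symmetric]) auto
  finally show ?case .
qed

definition unit_cell :: "'i set \<Rightarrow> ('i \<Rightarrow> real) set" where
  "unit_cell I = (\<Pi>\<^sub>E i\<in>I. {0..<1})"

lemma unit_cell_measurable[measurable]:
  "finite I \<Longrightarrow> unit_cell I \<in> sets (lebesgue_on_pi I)"
  unfolding unit_cell_def by (intro sets_PiM_I_finite) auto

lemma emeasure_unit_cell: "finite I \<Longrightarrow> emeasure (lebesgue_on_pi I) (unit_cell I) = 1"
  unfolding unit_cell_def by (subst lborel_product.emeasure_PiM) auto

text \<open>Each point lies in exactly one integer translate of the half-open cell, found by taking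
  floors. Tonelli moves the sum outside and translation invariance brings every piece back to the
  cell.\<close>

lemma nn_integral_unfold_lattice:
  fixes f :: "('i \<Rightarrow> real) \<Rightarrow> ennreal"
  assumes I: "finite I" and f[measurable]: "f \<in> borel_measurable (lebesgue_on_pi I)"
  shows "(\<integral>\<^sup>+x. f x \<partial>lebesgue_on_pi I) =
    (\<integral>\<^sup>+k. \<integral>\<^sup>+x. f (\<lambda>i\<in>I. x i + real_of_int (k i)) * indicator (unit_cell I) x \<partial>lebesgue_on_pi I
      \<partial>count_space (I \<rightarrow>\<^sub>E (UNIV :: int set)))"
proof -
  let ?K = "I \<rightarrow>\<^sub>E (UNIV :: int set)" and ?M = "lebesgue_on_pi I"
  have cK: "countable ?K" using I by (intro countable_PiE) auto
  have [measurable]: "unit_cell I \<in> sets ?M" by (rule unit_cell_measurable[OF I])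
  have tr[measurable]: "(\<lambda>x. \<lambda>i\<in>I. x i + - real_of_int (k i)) \<in> measurable ?M ?M" for k :: "'i \<Rightarrow> int"
    by (rule measurable_pi_translate)
  let ?g = "\<lambda>k x. f x * indicator (unit_cell I) (\<lambda>i\<in>I. x i + - real_of_int (k i))"
  have "(\<integral>\<^sup>+x. f x \<partial>?M) = (\<integral>\<^sup>+x. \<integral>\<^sup>+k. ?g k x \<partial>count_space ?K \<partial>?M)"
  proof (rule nn_integral_cong)
    fix x assume x: "x \<in> space ?M"
    define k0 where "k0 = (\<lambda>i\<in>I. \<lfloor>x i\<rfloor>)"
    have k0: "k0 \<in> ?K" by (simp add: k0_def)
    have "?g k x = f x * indicator {k0} k" if k: "k \<in> ?K" for k
    proof -
      have "(\<lambda>i\<in>I. x i + - real_of_int (k i)) \<in> unit_cell I \<longleftrightarrow> (\<forall>i\<in>I. k i = \<lfloor>x i\<rfloor>)"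
        by (auto simp: unit_cell_def PiE_iff floor_eq_iff eq_commute[of "k _"])
      also have "\<dots> \<longleftrightarrow> k = k0" using k by (auto simp: k0_def fun_eq_iff PiE_def extensional_def)
      finally show ?thesis by (simp add: indicator_def)
    qed
    then have "(\<integral>\<^sup>+k. ?g k x \<partial>count_space ?K) = (\<integral>\<^sup>+k. f x * indicator {k0} k \<partial>count_space ?K)"
      by (intro nn_integral_cong) simp
    also have "\<dots> = f x" using k0 by (simp add: nn_integral_cmult_indicator)
    finally show "f x = (\<integral>\<^sup>+k. ?g k x \<partial>count_space ?K)" ..
  qed
  also have "\<dots> = (\<integral>\<^sup>+k. \<integral>\<^sup>+x. ?g k x \<partial>?M \<partial>count_space ?K)"
    by (rule nn_integral_count_space_nn_integral[OF cK]) measurable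
  also have "\<dots> = (\<integral>\<^sup>+k. \<integral>\<^sup>+x. f (\<lambda>i\<in>I. x i + real_of_int (k i)) * indicator (unit_cell I) x \<partial>?M \<partial>count_space ?K)"
  proof (rule nn_integral_cong)
    fix k :: "'i \<Rightarrow> int"
    have "(\<integral>\<^sup>+x. ?g k x \<partial>?M) = (\<integral>\<^sup>+x. ?g k (\<lambda>i\<in>I. x i + real_of_int (k i)) \<partial>?M)"
      by (rule nn_integral_pi_translate[OF I, symmetric]) measurable
    also have "\<dots> = (\<integral>\<^sup>+x. f (\<lambda>i\<in>I. x i + real_of_int (k i)) * indicator (unit_cell I) x \<partial>?M)"
    proof (rule nn_integral_cong)
      fix x :: "'i \<Rightarrow> real" assume "x \<in> space ?M"
      then have "(\<lambda>i\<in>I. (\<lambda>i\<in>I. x i + real_of_int (k i)) i + - real_of_int (k i)) = x"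
        by (auto simp: fun_eq_iff space_PiM PiE_def extensional_def)
      then show "?g k (\<lambda>i\<in>I. x i + real_of_int (k i)) =
          f (\<lambda>i\<in>I. x i + real_of_int (k i)) * indicator (unit_cell I) x"
        by (simp only:)
    qed
    finally show "(\<integral>\<^sup>+x. ?g k x \<partial>?M) =
        (\<integral>\<^sup>+x. f (\<lambda>i\<in>I. x i + real_of_int (k i)) * indicator (unit_cell I) x \<partial>?M)" .
  qed
  finally show ?thesis .
qed

section \<open>Sums over families of integers\<close>

lemma nn_integral_count_space_infsum:
  fixes f :: "'a \<Rightarrow> real"
  assumes "f summable_on A" "\<And>x. x \<in> A \<Longrightarrow> 0 \<le> f x"
  shows "(\<integral>\<^sup>+x. ennreal (f x) \<partial>count_space A) = ennreal (infsum f A)"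
proof -
  have "Infinite_Set_Sum.abs_summable_on f A"
    using assms(1) abs_summable_equivalent[of f A] summable_on_iff_abs_summable_on_real[of f A] by simp
  then show ?thesis
    using nn_integral_conv_infsetsum[of f A] assms(2) infsetsum_infsum[of f A] by simp
qed

lemma nn_integral_pair_count_space:
  assumes "countable A" "countable B"
  shows "(\<integral>\<^sup>+x. \<integral>\<^sup>+y. f (x, y) \<partial>count_space B \<partial>count_space A) = (\<integral>\<^sup>+z. f z \<partial>count_space (A \<times> B))"
proof -
  interpret B: sigma_finite_measure "count_space B"
    by (rule sigma_finite_measure_count_space_countable[OF assms(2)])
  have "(\<integral>\<^sup>+x. \<integral>\<^sup>+y. f (x, y) \<partial>count_space B \<partial>count_space A) =
      integral\<^sup>N (count_space A \<Otimes>\<^sub>M count_space B) f"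
    by (rule B.nn_integral_fst) (simp add: pair_measure_countable assms)
  then show ?thesis by (simp add: pair_measure_countable assms)
qed

text \<open>A finite set of functions is contained in the product of its coordinate projections, so
  its sum is at most the product of the full one-dimensional sums.\<close>

lemma summable_on_prod_PiE_nonneg:
  fixes f :: "'i \<Rightarrow> 'k \<Rightarrow> real"
  assumes "finite I" "\<And>i. i \<in> I \<Longrightarrow> f i summable_on B i" "\<And>i k. 0 \<le> f i k"
  shows "(\<lambda>g. \<Prod>i\<in>I. f i (g i)) summable_on (PiE I B)"
proof (rule nonneg_bdd_above_summable_on)
  show "0 \<le> (\<Prod>i\<in>I. f i (g i))" for g by (intro prod_nonneg) (simp add: assms)
  show "bdd_above (sum (\<lambda>g. \<Prod>i\<in>I. f i (g i)) ` {F. F \<subseteq> PiE I B \<and> finite F})"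
  proof (rule bdd_aboveI2)
    fix X assume X: "X \<in> {F. F \<subseteq> PiE I B \<and> finite F}"
    define Y where "Y i = (\<lambda>g. g i) ` X" for i
    have Y: "finite (Y i)" "i \<in> I \<Longrightarrow> Y i \<subseteq> B i" for i using X by (auto simp: Y_def)
    have XY: "X \<subseteq> PiE I Y" using X by (auto simp: Y_def PiE_iff)
    have "(\<Sum>g\<in>X. \<Prod>i\<in>I. f i (g i)) \<le> (\<Sum>g\<in>PiE I Y. \<Prod>i\<in>I. f i (g i))"
      using Y(1) assms by (intro sum_mono2 finite_PiE XY prod_nonneg) auto
    also have "\<dots> = (\<Prod>i\<in>I. \<Sum>k\<in>Y i. f i k)"
      using assms(1) Y(1) by (simp add: prod_sum_PiE)
    also have "\<dots> \<le> (\<Prod>i\<in>I. infsum (f i) (B i))"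
      using Y assms by (intro prod_mono conjI sum_nonneg finite_sum_le_infsum) auto
    finally show "(\<Sum>g\<in>X. \<Prod>i\<in>I. f i (g i)) \<le> (\<Prod>i\<in>I. infsum (f i) (B i))" .
  qed
qed

text \<open>Under a product weight the characteristic function factors over the edges, and the
  bounds exp (- exp (- b/2) t(e)^2) multiply. The constant 1 contributes the total mass and keeps
  the summand nonnegative.\<close>

lemma
  fixes b :: real and t x :: "'e \<Rightarrow> real" and E :: "'e set"
  defines "P \<equiv> \<lambda>m. \<Prod>e\<in>E. ig_weight b (x e) (m e)"
  assumes b: "12 \<le> b" and E: "finite E"
  shows ig_weight_prod_sum_le:
    "(\<integral>\<^sup>+m. ennreal (P m) \<partial>count_space (E \<rightarrow>\<^sub>E UNIV)) \<le> 3 ^ card E"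
    and ig_weight_prod_cos_sum_le: "(\<And>e. e \<in> E \<Longrightarrow> \<bar>t e\<bar> \<le> 3 / 4) \<Longrightarrow>
      (\<integral>\<^sup>+m. ennreal ((1 + cos (2 * pi * (\<Sum>e\<in>E. t e * real_of_int (m e)))) * P m) \<partial>count_space (E \<rightarrow>\<^sub>E UNIV))
      \<le> ennreal (1 + exp (- exp (- (b / 2)) * (\<Sum>e\<in>E. (t e)\<^sup>2))) *
        (\<integral>\<^sup>+m. ennreal (P m) \<partial>count_space (E \<rightarrow>\<^sub>E UNIV))"
proof -
  let ?K = "E \<rightarrow>\<^sub>E (UNIV :: int set)"
  have w: "0 \<le> ig_weight b y k" for y k using ig_weight_pos[of b y k] by simp
  have ws: "ig_weight b y summable_on UNIV" for y by (rule ig_weight_summable[OF b])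
  have P0: "0 \<le> P m" for m unfolding P_def by (intro prod_nonneg w)
  have Ps: "P summable_on ?K" unfolding P_def by (intro summable_on_prod_PiE_nonneg E ws w)
  define Z where "Z = (\<Prod>e\<in>E. infsum (ig_weight b (x e)) UNIV)"
  have PZ: "infsum P ?K = Z" unfolding P_def Z_def
    using w ws by (intro infsum_prod_PiE_abs E) simp
  have nnP: "(\<integral>\<^sup>+m. ennreal (P m) \<partial>count_space ?K) = ennreal Z"
    using nn_integral_count_space_infsum[OF Ps] P0 PZ by simp
  have "Z \<le> (\<Prod>e\<in>E. 3)" unfolding Z_def
    using w by (intro prod_mono conjI infsum_nonneg ig_weight_sum_le[OF b])
  then have "ennreal Z \<le> ennreal (3 ^ card E)" by (intro ennreal_leI) simp
  also have "\<dots> = 3 ^ card E" by (simp add: ennreal_power[symmetric])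
  finally show "(\<integral>\<^sup>+m. ennreal (P m) \<partial>count_space ?K) \<le> 3 ^ card E" by (simp add: nnP)
  assume t: "\<And>e. e \<in> E \<Longrightarrow> \<bar>t e\<bar> \<le> 3 / 4"
  define \<rho> where "\<rho> = exp (- exp (- (b / 2)) * (\<Sum>e\<in>E. (t e)\<^sup>2))"
  define s where "s m = 2 * pi * (\<Sum>e\<in>E. t e * real_of_int (m e))" for m
  let ?f = "\<lambda>e k. complex_of_real (ig_weight b (x e) k) * cis (2 * (pi * t e) * real_of_int k)"
  have f: "(\<Prod>e\<in>E. ?f e (m e)) = complex_of_real (P m) * cis (s m)" for m
  proof -
    have "(\<Prod>e\<in>E. cis (2 * (pi * t e) * real_of_int (m e))) = cis (\<Sum>e\<in>E. 2 * (pi * t e) * real_of_int (m e))"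
      using E by (induction E rule: finite_induct) (auto simp: cis_mult)
    also have "(\<Sum>e\<in>E. 2 * (pi * t e) * real_of_int (m e)) = s m"
      by (simp add: s_def sum_distrib_left mult_ac)
    finally show ?thesis by (simp add: P_def prod.distrib)
  qed
  have nf: "norm (complex_of_real (P m) * cis (s m)) = P m" for m using P0 by (simp add: norm_mult)
  have Fs: "(\<lambda>m. complex_of_real (P m) * cis (s m)) summable_on ?K"
    by (rule abs_summable_summable) (simp only: nf Ps)
  have "infsum (\<lambda>m. \<Prod>e\<in>E. ?f e (m e)) ?K = (\<Prod>e\<in>E. infsum (?f e) UNIV)"
    using w ws by (intro infsum_prod_PiE_abs E) (simp add: norm_mult)
  then have F: "infsum (\<lambda>m. complex_of_real (P m) * cis (s m)) ?K = (\<Prod>e\<in>E. infsum (?f e) UNIV)"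
    by (simp only: f)
  have "norm (\<Prod>e\<in>E. infsum (?f e) UNIV) = (\<Prod>e\<in>E. norm (infsum (?f e) UNIV))" by (rule prod_norm[symmetric])
  also have "\<dots> \<le> (\<Prod>e\<in>E. exp (- exp (- (b / 2)) * (t e)\<^sup>2) * infsum (ig_weight b (x e)) UNIV)"
    using ig_char_bound[OF b] t by (intro prod_mono conjI) auto
  also have "\<dots> = \<rho> * Z"
    unfolding prod.distrib \<rho>_def Z_def sum_distrib_left exp_sum[OF E] by simp
  finally have Fle: "norm (\<Prod>e\<in>E. infsum (?f e) UNIV) \<le> \<rho> * Z" .
  have hs: "((\<lambda>m. complex_of_real (P m) * cis (s m)) has_sum (\<Prod>e\<in>E. infsum (?f e) UNIV)) ?K"
    using has_sum_infsum[OF Fs] by (simp only: F)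
  have hsc: "((\<lambda>m. P m * cos (s m)) has_sum Re (\<Prod>e\<in>E. infsum (?f e) UNIV)) ?K"
    using has_sum_Re[OF hs] by simp
  have hsP: "(P has_sum Z) ?K" using has_sum_infsum[OF Ps] by (simp only: PZ)
  have hs1: "((\<lambda>m. (1 + cos (s m)) * P m) has_sum (Z + Re (\<Prod>e\<in>E. infsum (?f e) UNIV))) ?K"
    using has_sum_add[OF hsP hsc] by (simp add: algebra_simps)
  have nn: "0 \<le> (1 + cos (s m)) * P m" for m
    using P0[of m] cos_ge_minus_one[of "s m"] by (intro mult_nonneg_nonneg) linarith+
  have "(\<integral>\<^sup>+m. ennreal ((1 + cos (s m)) * P m) \<partial>count_space ?K) = ennreal (Z + Re (\<Prod>e\<in>E. infsum (?f e) UNIV))"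
    using nn_integral_count_space_infsum[OF has_sum_imp_summable[OF hs1]] nn infsumI[OF hs1] by simp
  also have "\<dots> \<le> ennreal ((1 + \<rho>) * Z)"
    using Fle complex_Re_le_cmod[of "\<Prod>e\<in>E. infsum (?f e) UNIV"]
    by (intro ennreal_leI) (simp add: algebra_simps)
  also have "\<dots> = ennreal (1 + \<rho>) * ennreal Z"
    using infsum_nonneg[of ?K P] P0 PZ by (intro ennreal_mult) (auto simp: \<rho>_def)
  finally show "(\<integral>\<^sup>+m. ennreal ((1 + cos (2 * pi * (\<Sum>e\<in>E. t e * real_of_int (m e)))) * P m) \<partial>count_space ?K)
      \<le> ennreal (1 + exp (- exp (- (b / 2)) * (\<Sum>e\<in>E. (t e)\<^sup>2))) *
        (\<integral>\<^sup>+m. ennreal (P m) \<partial>count_space ?K)"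
    unfolding nnP s_def \<rho>_def .
qed

section \<open>Unfolding the Coulomb gas to the edges\<close>

context rooted_face_graph
begin

definition coulomb_weight :: "real \<Rightarrow> ('f \<Rightarrow> int) \<Rightarrow> real" where
  "coulomb_weight b q = exp (- (b / 2) *
     form_inner G (\<lambda>f. real_of_int (q f)) (inv_neg_laplacian G (\<lambda>f. real_of_int (q f))))"

end

context face_graph_with_tree
begin

abbreviation "cell_measure \<equiv> lebesgue_on_pi S"
abbreviation "int_edge_forms \<equiv> E \<rightarrow>\<^sub>E (UNIV :: int set)"

definition gauss :: "real \<Rightarrow> ('e \<Rightarrow> real) \<Rightarrow> real" where
  "gauss b m = exp (- (b / 2) * (\<Sum>e\<in>E. (m e)\<^sup>2))"

lemma gauss_pos: "0 < gauss b m"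
  by (simp add: gauss_def)

lemma gauss_cong: "(\<And>e. e \<in> E \<Longrightarrow> m e = m' e) \<Longrightarrow> gauss b m = gauss b m'"
  by (simp add: gauss_def)

lemma gauss_prod: "gauss b (\<lambda>e. real_of_int (m e) + x e) = (\<Prod>e\<in>E. ig_weight b (- x e) (m e))"
  by (simp add: gauss_def ig_weight_def sum_distrib_left exp_sum[OF finite_edges])

lemma measurable_kernel_form[measurable]:
  "(\<lambda>\<theta>. kernel_form \<theta> e) \<in> borel_measurable cell_measure"
  unfolding kernel_form_def
  by (intro borel_measurable_sum borel_measurable_times borel_measurable_const)
    (use measurable_component_singleton[of _ S "\<lambda>_. lborel :: real measure"] in simp)

lemma measurable_gauss[measurable]:
  "(\<lambda>\<theta>. gauss b (\<lambda>e. x e + kernel_form \<theta> e)) \<in> borel_measurable cell_measure"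
  unfolding gauss_def by measurable

text \<open>The Gaussian integral over the real divergence-free forms in tree coordinates. It
  multiplies both sides of the final comparison and is cancelled there.\<close>

definition gauss_const :: "real \<Rightarrow> ennreal" where
  "gauss_const b = (\<integral>\<^sup>+\<theta>. ennreal (gauss b (kernel_form \<theta>)) \<partial>cell_measure)"

text \<open>The integrand is positive everywhere, and the unit cell shows that the space is not a
  null set.\<close>

lemma gauss_const_nonzero: "gauss_const b \<noteq> 0"
proof
  assume "gauss_const b = 0"
  moreover have m: "(\<lambda>\<theta>. ennreal (gauss b (kernel_form \<theta>))) \<in> borel_measurable cell_measure"
    using measurable_gauss[of b "\<lambda>_. 0"] by simp
  ultimately have "AE \<theta> in cell_measure. ennreal (gauss b (kernel_form \<theta>)) = 0"
    unfolding gauss_const_def by (simp add: nn_integral_0_iff_AE)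
  then have "AE \<theta> in cell_measure. False" 
    by (rule eventually_mono) (use gauss_pos[of b] in \<open>simp add: ennreal_eq_0_iff flip: not_less\<close>)
  then have "emeasure cell_measure (space cell_measure) = 0" by (simp add: AE_iff_measurable[OF _ refl])
  moreover have "emeasure cell_measure (unit_cell S) \<le> emeasure cell_measure (space cell_measure)"
    by (rule emeasure_space)
  ultimately show False using emeasure_unit_cell[OF finite_S] by simp
qed

text \<open>The closest point to 0 in the affine space of real forms with divergence \<open>q\<close> is a gradient.\<close>

lemma nn_integral_gauss_lift:
  "(\<integral>\<^sup>+\<theta>. ennreal (gauss b (\<lambda>e. lift_form (\<lambda>f. real_of_int (q f)) e + kernel_form \<theta> e)) \<partial>cell_measure)
    = ennreal (coulomb_weight b q) * gauss_const b" if q: "q \<in> two_forms G"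
proof -
  define u where "u = (\<lambda>f. real_of_int (q f))"
  have u: "u \<in> two_forms G" using q by (auto simp: u_def two_forms_def)
  define h where "h = inv_neg_laplacian G u"
  have h: "h \<in> two_forms G" unfolding h_def by (rule inv_neg_laplacian_in)
  have dh: "dvg (grad h) = u" unfolding h_def dvg_grad_inv_neg_laplacian to_two_form_id[OF u] ..
  \<comment> \<open>The tree lift and the gradient minimiser have the same divergence, so
    \<open>d\<close> is a mere translation of the coordinates, which Lebesgue measure
    ignores.\<close>
  define d where "d = (\<lambda>e. lift_form u e + (-1) * grad h e)"
  have "dvg d = (\<lambda>_. 0)" unfolding d_def by (simp only: fun_eq_iff dvg_add dvg_lift_form[OF u] dh) simp
  then have "lift_form (dvg d) e = 0" for e by (simp add: lift_form_def)
  then have dk: "d e = kernel_form d e" if "e \<in> E" for e using form_decomposition[OF that, of d] by simp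
  have split: "gauss b (\<lambda>e. lift_form u e + kernel_form \<theta> e) =
      coulomb_weight b q * gauss b (kernel_form (\<lambda>s\<in>S. \<theta> s + d s))" for \<theta>
  proof -
    let ?k = "kernel_form (\<lambda>s\<in>S. \<theta> s + d s)"
    have k: "?k e = kernel_form \<theta> e + d e" if "e \<in> E" for e
    proof -
      have "?k = kernel_form (\<lambda>s. \<theta> s + d s)" by (rule kernel_form_cong) simp
      then show ?thesis using dk[OF that] by (simp add: kernel_form_add)
    qed
    have "(\<Sum>e\<in>E. grad h e * ?k e) = form_inner G h (dvg ?k)" by (rule form_inner_dvg[OF h, symmetric])
    also have "\<dots> = 0" by (simp add: form_inner_def dvg_kernel_form)
    finally have orth: "(\<Sum>e\<in>E. grad h e * ?k e) = 0" .
    have "(\<Sum>e\<in>E. (lift_form u e + kernel_form \<theta> e)\<^sup>2) = (\<Sum>e\<in>E. (grad h e + ?k e)\<^sup>2)"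
      by (intro sum.cong refl) (simp only: k, simp add: d_def add.commute)
    also have "\<dots> = (\<Sum>e\<in>E. (grad h e)\<^sup>2) + (\<Sum>e\<in>E. (?k e)\<^sup>2) + 2 * (\<Sum>e\<in>E. grad h e * ?k e)"
      by (simp add: power2_sum sum.distrib sum_distrib_left mult.assoc)
    also have "\<dots> = form_inner G u h + (\<Sum>e\<in>E. (?k e)\<^sup>2)"
      unfolding orth by (simp add: h_def form_inner_inv_neg_laplacian)
    finally show ?thesis
      unfolding gauss_def coulomb_weight_def u_def[symmetric] h_def[symmetric]
      by (simp add: distrib_left flip: exp_add)
  qed
  have m[measurable]: "(\<lambda>\<theta>. ennreal (gauss b (kernel_form \<theta>))) \<in> borel_measurable cell_measure"
    using measurable_gauss[of b "\<lambda>_. 0"] by simp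
  have m': "(\<lambda>\<theta>. ennreal (gauss b (kernel_form (\<lambda>s\<in>S. \<theta> s + d s)))) \<in> borel_measurable cell_measure"
    by (rule measurable_compose[OF measurable_pi_translate m])
  have "(\<integral>\<^sup>+\<theta>. ennreal (gauss b (\<lambda>e. lift_form u e + kernel_form \<theta> e)) \<partial>cell_measure) =
      (\<integral>\<^sup>+\<theta>. ennreal (coulomb_weight b q) * ennreal (gauss b (kernel_form (\<lambda>s\<in>S. \<theta> s + d s))) \<partial>cell_measure)"
    unfolding split by (simp add: ennreal_mult' coulomb_weight_def)
  also have "\<dots> = ennreal (coulomb_weight b q) *
      (\<integral>\<^sup>+\<theta>. ennreal (gauss b (kernel_form (\<lambda>s\<in>S. \<theta> s + d s))) \<partial>cell_measure)"
    by (rule nn_integral_cmult[OF m'])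
  also have "(\<integral>\<^sup>+\<theta>. ennreal (gauss b (kernel_form (\<lambda>s\<in>S. \<theta> s + d s))) \<partial>cell_measure) = gauss_const b"
    unfolding gauss_const_def by (rule nn_integral_pi_translate[OF finite_S m])
  finally show ?thesis unfolding u_def .
qed

lemma countable_int_edge_forms: "countable int_edge_forms"
  using finite_edges by (intro countable_PiE) auto

lemma countable_int_two_forms: "countable (two_forms G :: ('f \<Rightarrow> int) set)"
proof -
  have "countable ((two_forms G :: ('f \<Rightarrow> int) set) \<times> (S \<rightarrow>\<^sub>E (UNIV :: int set)))"
    by (rule countableI_bij2[OF bij_lift_kernel countable_int_edge_forms])
  then have "countable (fst ` ((two_forms G :: ('f \<Rightarrow> int) set) \<times> (S \<rightarrow>\<^sub>E (UNIV :: int set))))"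
    by (rule countable_image)
  moreover have "(S \<rightarrow>\<^sub>E (UNIV :: int set)) \<noteq> {}" by (simp add: PiE_eq_empty_iff)
  ultimately show ?thesis by (simp only: fst_image_times if_False)
qed

text \<open>For each charge the integral over the whole space is unfolded to the cell; the pair of
  charge and lattice translate is then one integer form. Taking \<open>\<phi>\<close> in
  \<open>ennreal\<close> makes every interchange an instance of Tonelli.\<close>

lemma coulomb_sum_eq_edge_integral:
  fixes \<phi> :: "('f \<Rightarrow> int) \<Rightarrow> ennreal"
  shows "(\<integral>\<^sup>+q. \<phi> q * ennreal (coulomb_weight b q) \<partial>count_space (two_forms G)) * gauss_const b =
    (\<integral>\<^sup>+\<theta>. (\<integral>\<^sup>+m. \<phi> (dvg m) * ennreal (gauss b (\<lambda>e. real_of_int (m e) + kernel_form \<theta> e))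
      \<partial>count_space int_edge_forms) * indicator (unit_cell S) \<theta> \<partial>cell_measure)"
proof -
  let ?Q = "two_forms G :: ('f \<Rightarrow> int) set" and ?K = "S \<rightarrow>\<^sub>E (UNIV :: int set)"
  let ?u = "\<lambda>q f. real_of_int (q f)"
  let ?f = "\<lambda>(q, k). \<lambda>e\<in>E. lift_form q e + kernel_form k e :: int"
  let ?I = "\<lambda>m. \<integral>\<^sup>+\<theta>. \<phi> (dvg m) * ennreal (gauss b (\<lambda>e. real_of_int (m e) + kernel_form \<theta> e))
      * indicator (unit_cell S) \<theta> \<partial>cell_measure"
  have [measurable]: "unit_cell S \<in> sets cell_measure" by (rule unit_cell_measurable[OF finite_S])
  have cK: "countable ?K" using finite_S by (intro countable_PiE) auto
  have one: "\<phi> q * ennreal (coulomb_weight b q) * gauss_const b =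
      (\<integral>\<^sup>+k. ?I (?f (q, k)) \<partial>count_space ?K)" if q: "q \<in> ?Q" for q
  proof -
    have "\<phi> q * ennreal (coulomb_weight b q) * gauss_const b = \<phi> q *
      (\<integral>\<^sup>+\<theta>. ennreal (gauss b (\<lambda>e. lift_form (?u q) e + kernel_form \<theta> e)) \<partial>cell_measure)"
      by (simp add: nn_integral_gauss_lift[OF q] mult.assoc)
    also have "(\<integral>\<^sup>+\<theta>. ennreal (gauss b (\<lambda>e. lift_form (?u q) e + kernel_form \<theta> e)) \<partial>cell_measure) =
      (\<integral>\<^sup>+k. \<integral>\<^sup>+\<theta>. ennreal (gauss b (\<lambda>e. lift_form (?u q) e +
        kernel_form (\<lambda>s\<in>S. \<theta> s + real_of_int (k s)) e)) * indicator (unit_cell S) \<theta> \<partial>cell_measure \<partial>count_space ?K)"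
      by (rule nn_integral_unfold_lattice[OF finite_S]) measurable
    also have "\<dots> = (\<integral>\<^sup>+k. \<integral>\<^sup>+\<theta>. ennreal (gauss b (\<lambda>e. real_of_int (?f (q, k) e) + kernel_form \<theta> e))
        * indicator (unit_cell S) \<theta> \<partial>cell_measure \<partial>count_space ?K)"
    proof (intro nn_integral_cong arg_cong2[of _ _ _ _ times] arg_cong[of _ _ ennreal] gauss_cong refl)
      fix k :: "'e \<Rightarrow> int" and \<theta> :: "'e \<Rightarrow> real" and e assume e: "e \<in> E"
      have "kernel_form (\<lambda>s\<in>S. \<theta> s + real_of_int (k s)) = kernel_form (\<lambda>s. \<theta> s + real_of_int (k s))"
        by (rule kernel_form_cong) simp
      then have "kernel_form (\<lambda>s\<in>S. \<theta> s + real_of_int (k s)) e = kernel_form \<theta> e + real_of_int (kernel_form k e)"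
        by (simp add: kernel_form_add of_int_kernel_form)
      moreover have "lift_form (?u q) e = real_of_int (lift_form q e)" by (simp add: lift_form_def)
      ultimately show "lift_form (?u q) e + kernel_form (\<lambda>s\<in>S. \<theta> s + real_of_int (k s)) e =
          real_of_int (?f (q, k) e) + kernel_form \<theta> e" using e by simp
    qed
    also have "\<phi> q * \<dots> = (\<integral>\<^sup>+k. \<phi> q * (\<integral>\<^sup>+\<theta>. ennreal (gauss b (\<lambda>e. real_of_int (?f (q, k) e) + kernel_form \<theta> e))
        * indicator (unit_cell S) \<theta> \<partial>cell_measure) \<partial>count_space ?K)"
      by (rule nn_integral_cmult[symmetric]) simp
    also have "\<dots> = (\<integral>\<^sup>+k. ?I (?f (q, k)) \<partial>count_space ?K)"
    proof (rule nn_integral_cong)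
      fix k :: "'e \<Rightarrow> int"
      have d: "dvg (?f (q, k)) = q"
      proof -
        have "dvg (?f (q, k)) = dvg (\<lambda>e. lift_form q e + 1 * kernel_form k e)"
          by (rule dvg_cong) simp
        then show ?thesis
          by (simp only: dvg_add fun_eq_iff dvg_lift_form[OF q] dvg_kernel_form) simp
      qed
      show "\<phi> q * (\<integral>\<^sup>+\<theta>. ennreal (gauss b (\<lambda>e. real_of_int (?f (q, k) e) + kernel_form \<theta> e))
          * indicator (unit_cell S) \<theta> \<partial>cell_measure) = ?I (?f (q, k))"
        unfolding d mult.assoc by (rule nn_integral_cmult[symmetric]) measurable
    qed
    finally show ?thesis .
  qed
  have "(\<integral>\<^sup>+q. \<phi> q * ennreal (coulomb_weight b q) \<partial>count_space ?Q) * gauss_const b =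
      (\<integral>\<^sup>+q. \<phi> q * ennreal (coulomb_weight b q) * gauss_const b \<partial>count_space ?Q)"
    by (rule nn_integral_multc[symmetric]) simp
  also have "\<dots> = (\<integral>\<^sup>+q. \<integral>\<^sup>+k. ?I (?f (q, k)) \<partial>count_space ?K \<partial>count_space ?Q)"
    using one by (intro nn_integral_cong) simp
  also have "\<dots> = (\<integral>\<^sup>+z. ?I (?f z) \<partial>count_space (?Q \<times> ?K))"
    by (rule nn_integral_pair_count_space[OF countable_int_two_forms cK])
  also have "\<dots> = (\<integral>\<^sup>+m. ?I m \<partial>count_space int_edge_forms)"
    by (rule nn_integral_bij_count_space[OF bij_lift_kernel])
  also have "\<dots> = (\<integral>\<^sup>+\<theta>. (\<integral>\<^sup>+m. \<phi> (dvg m) * ennreal (gauss b (\<lambda>e. real_of_int (m e) + kernel_form \<theta> e))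
      * indicator (unit_cell S) \<theta> \<partial>count_space int_edge_forms) \<partial>cell_measure)"
    by (rule nn_integral_count_space_nn_integral[OF countable_int_edge_forms, symmetric]) measurable
  also have "\<dots> = (\<integral>\<^sup>+\<theta>. (\<integral>\<^sup>+m. \<phi> (dvg m) * ennreal (gauss b (\<lambda>e. real_of_int (m e) + kernel_form \<theta> e))
      \<partial>count_space int_edge_forms) * indicator (unit_cell S) \<theta> \<partial>cell_measure)"
    by (intro nn_integral_cong nn_integral_multc) simp
  finally show ?thesis .
qed

text \<open>Each edge contributes at most 3 whatever its centre, and the cell has measure 1.\<close>

lemma coulomb_sum_finite:
  assumes b: "12 \<le> b"
  shows "(\<integral>\<^sup>+q. ennreal (coulomb_weight b q) \<partial>count_space (two_forms G)) * gauss_const b < \<infinity>"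
proof -
  have "(\<integral>\<^sup>+q. ennreal (coulomb_weight b q) \<partial>count_space (two_forms G)) * gauss_const b =
    (\<integral>\<^sup>+\<theta>. (\<integral>\<^sup>+m. ennreal (gauss b (\<lambda>e. real_of_int (m e) + kernel_form \<theta> e))
      \<partial>count_space int_edge_forms) * indicator (unit_cell S) \<theta> \<partial>cell_measure)"
    using coulomb_sum_eq_edge_integral[of "\<lambda>_. 1" b] by simp
  also have "\<dots> \<le> (\<integral>\<^sup>+\<theta>. 3 ^ card E * indicator (unit_cell S) \<theta> \<partial>cell_measure)"
    unfolding gauss_prod
    by (intro nn_integral_mono mult_right_mono ig_weight_prod_sum_le[OF b finite_edges]) simp
  also have "\<dots> = 3 ^ card E"
    using unit_cell_measurable[OF finite_S] emeasure_unit_cell[OF finite_S]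
    by (simp add: nn_integral_cmult_indicator)
  also have "\<dots> < \<infinity>" by (simp add: power_less_top_ennreal)
  finally show ?thesis .
qed

lemma coulomb_weight_0: "coulomb_weight b (\<lambda>_. 0) = 1"
  by (simp add: coulomb_weight_def form_inner_def)

lemma zero_in_two_forms: "(\<lambda>_. 0) \<in> two_forms G"
  by (simp add: two_forms_def)

lemma coulomb_sum_ge_1: "1 \<le> (\<integral>\<^sup>+q. ennreal (coulomb_weight b q) \<partial>count_space (two_forms G))"
proof -
  have "1 = (\<integral>\<^sup>+q. indicator {\<lambda>_. 0} q \<partial>count_space (two_forms G :: ('f \<Rightarrow> int) set))"
    using zero_in_two_forms by (subst nn_integral_indicator) auto
  also have "\<dots> \<le> (\<integral>\<^sup>+q. ennreal (coulomb_weight b q) \<partial>count_space (two_forms G))"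
    by (intro nn_integral_mono) (auto simp: indicator_def coulomb_weight_0)
  finally show ?thesis .
qed

text \<open>A factor of a finite product whose other factor is at least 1; no Gaussian integral has
  to be evaluated.\<close>

lemma gauss_const_finite: "12 \<le> b \<Longrightarrow> gauss_const b \<noteq> \<infinity>"
  using coulomb_sum_finite[of b] coulomb_sum_ge_1[of b] by (auto simp: ennreal_mult_top split: if_splits)

text \<open>The same finite product read the other way: its Gaussian factor is nonzero, so the sum
  over charges is finite.\<close>

lemma coulomb_weight_summable:
  assumes b: "12 \<le> b"
  shows "coulomb_weight b summable_on two_forms G"
proof -
  have "(\<integral>\<^sup>+q. ennreal (coulomb_weight b q) \<partial>count_space (two_forms G)) < \<infinity>"
    using coulomb_sum_finite[OF b] gauss_const_nonzero[of b]
    by (cases "(\<integral>\<^sup>+q. ennreal (coulomb_weight b q) \<partial>count_space (two_forms G)) = \<infinity>")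
      (auto simp: ennreal_top_mult less_top)
  then have "integrable (count_space (two_forms G)) (coulomb_weight b)"
    by (intro integrableI_nonneg) (auto simp: coulomb_weight_def)
  then show ?thesis
    using abs_summable_equivalent[of "coulomb_weight b" "two_forms G"]
      summable_on_iff_abs_summable_on_real[of "coulomb_weight b" "two_forms G"]
    by (simp add: abs_summable_on_def)
qed

text \<open>The edge bounds are uniform in the centres, hence hold for each \<theta> separately and
  survive integration over the cell. Folding back and cancelling the Gaussian constant gives the
  claim.\<close>

lemma coulomb_cos_sum_le:
  assumes b: "12 \<le> b" and f: "f \<in> faces G" "f' \<in> faces G"
    and bound: "\<And>e. e \<in> E \<Longrightarrow> \<bar>grad (potential f f') e\<bar> \<le> 3 / 4"
  defines "X \<equiv> \<lambda>q. inv_laplacian G (\<lambda>x. real_of_int (q x)) f - inv_laplacian G (\<lambda>x. real_of_int (q x)) f'"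
  shows "(\<integral>\<^sup>+q. ennreal (1 + cos (2 * pi * X q)) * ennreal (coulomb_weight b q) \<partial>count_space (two_forms G))
    \<le> ennreal (1 + exp (- exp (- (b / 2)) * form_inner G (dipole f f') (potential f f'))) *
      (\<integral>\<^sup>+q. ennreal (coulomb_weight b q) \<partial>count_space (two_forms G))"
proof -
  let ?t = "grad (potential f f')"
  let ?\<rho> = "exp (- exp (- (b / 2)) * form_inner G (dipole f f') (potential f f'))"
  let ?W = "\<integral>\<^sup>+q. ennreal (coulomb_weight b q) \<partial>count_space (two_forms G)"
  let ?V = "\<integral>\<^sup>+q. ennreal (1 + cos (2 * pi * X q)) * ennreal (coulomb_weight b q) \<partial>count_space (two_forms G)"
  \<comment> \<open>The minus sign of \<open>inv_laplacian_difference\<close> disappears because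
    cosine is even.\<close>
  have X: "cos (2 * pi * X (dvg m)) = cos (2 * pi * (\<Sum>e\<in>E. ?t e * real_of_int (m e)))" for m :: "'e \<Rightarrow> int"
  proof -
    have "(\<lambda>x. real_of_int (dvg m x)) = dvg (\<lambda>e. real_of_int (m e))"
      by (simp add: dvg_def fun_eq_iff)
    then have "to_two_form G (\<lambda>x. real_of_int (dvg m x)) = dvg (\<lambda>e. real_of_int (m e))"
      by (simp add: to_two_form_id[OF dvg_two_form])
    from inv_laplacian_difference[OF f this] show ?thesis unfolding X_def by simp
  qed
  have "?V * gauss_const b =
    (\<integral>\<^sup>+\<theta>. (\<integral>\<^sup>+m. ennreal (1 + cos (2 * pi * X (dvg m))) * ennreal (gauss b (\<lambda>e. real_of_int (m e) + kernel_form \<theta> e))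
      \<partial>count_space int_edge_forms) * indicator (unit_cell S) \<theta> \<partial>cell_measure)"
    by (rule coulomb_sum_eq_edge_integral)
  also have "\<dots> \<le> (\<integral>\<^sup>+\<theta>. (\<integral>\<^sup>+m. ennreal (1 + ?\<rho>) * ennreal (gauss b (\<lambda>e. real_of_int (m e) + kernel_form \<theta> e))
      \<partial>count_space int_edge_forms) * indicator (unit_cell S) \<theta> \<partial>cell_measure)"
  proof (rule nn_integral_mono)
    fix \<theta> :: "'e \<Rightarrow> real"
    have "(\<integral>\<^sup>+m. ennreal (1 + cos (2 * pi * X (dvg m))) * ennreal (gauss b (\<lambda>e. real_of_int (m e) + kernel_form \<theta> e))
        \<partial>count_space int_edge_forms) =
      (\<integral>\<^sup>+m. ennreal ((1 + cos (2 * pi * (\<Sum>e\<in>E. ?t e * real_of_int (m e)))) *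
        (\<Prod>e\<in>E. ig_weight b (- kernel_form \<theta> e) (m e))) \<partial>count_space int_edge_forms)"
      unfolding X gauss_prod
      by (intro nn_integral_cong ennreal_mult'[symmetric])
        (use cos_ge_minus_one in \<open>simp add: add.commute[of 1] flip: diff_le_eq\<close>)
    also have "\<dots> \<le> ennreal (1 + exp (- exp (- (b / 2)) * (\<Sum>e\<in>E. (?t e)\<^sup>2))) *
      (\<integral>\<^sup>+m. ennreal (\<Prod>e\<in>E. ig_weight b (- kernel_form \<theta> e) (m e)) \<partial>count_space int_edge_forms)"
      by (rule ig_weight_prod_cos_sum_le[OF b finite_edges bound])
    also have "(\<Sum>e\<in>E. (?t e)\<^sup>2) = form_inner G (dipole f f') (potential f f')"
      by (rule form_inner_inv_neg_laplacian[symmetric])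
    also have "ennreal (1 + ?\<rho>) * (\<integral>\<^sup>+m. ennreal (\<Prod>e\<in>E. ig_weight b (- kernel_form \<theta> e) (m e)) \<partial>count_space int_edge_forms) =
      (\<integral>\<^sup>+m. ennreal (1 + ?\<rho>) * ennreal (gauss b (\<lambda>e. real_of_int (m e) + kernel_form \<theta> e)) \<partial>count_space int_edge_forms)"
      unfolding gauss_prod by (rule nn_integral_cmult[symmetric]) simp
    finally show "(\<integral>\<^sup>+m. ennreal (1 + cos (2 * pi * X (dvg m))) * ennreal (gauss b (\<lambda>e. real_of_int (m e) + kernel_form \<theta> e))
        \<partial>count_space int_edge_forms) * indicator (unit_cell S) \<theta>
      \<le> (\<integral>\<^sup>+m. ennreal (1 + ?\<rho>) * ennreal (gauss b (\<lambda>e. real_of_int (m e) + kernel_form \<theta> e))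
        \<partial>count_space int_edge_forms) * indicator (unit_cell S) \<theta>"
      by (rule mult_right_mono) simp
  qed
  also have "\<dots> = (\<integral>\<^sup>+q. ennreal (1 + ?\<rho>) * ennreal (coulomb_weight b q) \<partial>count_space (two_forms G)) * gauss_const b"
    by (rule coulomb_sum_eq_edge_integral[symmetric])
  also have "(\<integral>\<^sup>+q. ennreal (1 + ?\<rho>) * ennreal (coulomb_weight b q) \<partial>count_space (two_forms G)) =
      ennreal (1 + ?\<rho>) * ?W"
    by (rule nn_integral_cmult) simp
  finally have "?V * gauss_const b \<le> (ennreal (1 + ?\<rho>) * ?W) * gauss_const b" .
  then show ?thesis
    using gauss_const_nonzero[of b] gauss_const_finite[OF b]
    by (simp add: ennreal_mult_le_mult_iff mult.commute[of _ "gauss_const b"])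
qed

end

section \<open>Cycles in the square-grid boxes\<close>

definition star :: "int \<times> int \<Rightarrow> ((int \<times> int) \<times> (int \<times> int)) set" where
  "star v = (case v of (i, j) \<Rightarrow>
     {((i, j), (i + 1, j)), ((i, j), (i, j + 1)), ((i - 1, j), (i, j)), ((i, j - 1), (i, j))})"

lemma lattice_edge_in_star:
  assumes "e \<in> lattice_edges" "v = fst e \<or> v = snd e"
  shows "e \<in> star v"
proof -
  obtain i j where "e = ((i, j), (i + 1, j)) \<or> e = ((i, j), (i, j + 1))"
    using assms(1) unfolding lattice_edges_def by blast
  then show ?thesis using assms(2) by (elim disjE) (simp_all add: star_def)
qed

lemma star_subset: "star v \<subseteq> lattice_edges"
  by (cases v) (auto simp: star_def lattice_edges_def)

text \<open>The dual edges crossing the edges of a star form a cycle around its centre.\<close>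

lemma star_cycle:
  fixes u :: "int \<times> int \<Rightarrow> real"
  assumes "e \<in> star v"
  shows "\<bar>u (left_square e) - u (right_square e)\<bar>
    \<le> (\<Sum>d\<in>star v - {e}. \<bar>u (left_square d) - u (right_square d)\<bar>)"
proof (cases v)
  case (Pair i j)
  let ?r = "((i, j), (i + 1, j))" and ?u = "((i, j), (i, j + 1))"
    and ?l = "((i - 1, j), (i, j))" and ?d = "((i, j - 1), (i, j))"
  have st: "star v = {?r, ?u, ?l, ?d}" by (simp add: star_def Pair)
  consider "e = ?r" | "e = ?u" | "e = ?l" | "e = ?d" using assms unfolding st by blast
  then show ?thesis
  proof cases
    case 1
    then have "star v - {e} = {?u, ?l, ?d}" unfolding st by auto
    then show ?thesis using 1 by simp
  next
    case 2
    then have "star v - {e} = {?r, ?l, ?d}" unfolding st by auto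
    then show ?thesis using 2 by simp
  next
    case 3
    then have "star v - {e} = {?r, ?u, ?d}" unfolding st by auto
    then show ?thesis using 3 by simp
  next
    case 4
    then have "star v - {e} = {?r, ?u, ?l}" unfolding st by auto
    then show ?thesis using 4 by simp
  qed
qed

lemma card_star_Diff: "e \<in> star v \<Longrightarrow> card (star v - {e}) \<le> 3"
proof -
  assume e: "e \<in> star v"
  have "finite (star v)" "card (star v) \<le> 4"
    by (auto simp: star_def card_insert_if split: prod.split)
  then show ?thesis using e by (simp add: card_Diff_singleton)
qed

lemma star_detour:
  fixes c :: "int \<times> int \<Rightarrow> 'f" and g :: "'f \<Rightarrow> real"
  assumes e: "e \<in> star v"
    and out: "\<And>d. d \<in> star v \<Longrightarrow> d \<notin> E \<Longrightarrow> c (left_square d) = c (right_square d)"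
  shows "\<bar>g (c (left_square e)) - g (c (right_square e))\<bar>
    \<le> (\<Sum>d\<in>(star v - {e}) \<inter> E. \<bar>g (c (left_square d)) - g (c (right_square d))\<bar>)"
proof -
  have "finite (star v)" by (auto simp: star_def split: prod.split)
  then have "(\<Sum>d\<in>(star v - {e}) \<inter> E. \<bar>g (c (left_square d)) - g (c (right_square d))\<bar>)
      = (\<Sum>d\<in>star v - {e}. \<bar>g (c (left_square d)) - g (c (right_square d))\<bar>)"
  proof (intro sum.mono_neutral_left ballI)
    fix d assume "d \<in> star v - {e} - (star v - {e}) \<inter> E"
    then have "d \<in> star v" "d \<notin> E" by blast+
    then show "\<bar>g (c (left_square d)) - g (c (right_square d))\<bar> = 0" by (simp add: out)
  qed auto
  then show ?thesis using star_cycle[OF e, of "g \<circ> c"] by simp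
qed

lemma star_detour_card: "e \<in> star v \<Longrightarrow> card ((star v - {e}) \<inter> E) \<le> 3"
  using card_star_Diff[of e v] card_mono[of "star v - {e}" "(star v - {e}) \<inter> E"]
  by (force simp: star_def split: prod.splits)

section \<open>Connectedness and detours in the two kinds of boxes\<close>

lemma finite_box: "finite (box n)"
  by (simp add: box_def)

text \<open>Every row of squares is entered from the unbounded face through its left side and then
  traversed to the right.\<close>

lemma free_box_rooted: "rooted_face_graph (free_box n)"
proof
  let ?G = "free_box n" and ?n = "int n"
  have "edges ?G \<subseteq> box n \<times> box n" by (auto simp: free_box_def)
  then show "finite (edges ?G)" by (rule finite_subset) (simp add: finite_box)
  show "finite (faces ?G)" by (simp add: free_box_def inner_squares_def)
  show "left_face ?G e \<in> faces ?G \<and> right_face ?G e \<in> faces ?G" if "e \<in> edges ?G" for e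
    by (auto simp: free_box_def collapse_outside_def)
  show "marked_face ?G \<in> faces ?G" by (simp add: free_box_def)
  show "faces ?G \<subseteq> A" if m: "marked_face ?G \<in> A"
    and cl: "\<And>e. e \<in> edges ?G \<Longrightarrow> left_face ?G e \<in> A \<longleftrightarrow> right_face ?G e \<in> A" for A
  proof -
    have row: "collapse_outside (inner_squares n) (i - 1, j) \<in> A \<Longrightarrow> collapse_outside (inner_squares n) (i, j) \<in> A"
      if "- ?n \<le> i" "i \<le> ?n - 1" "- ?n \<le> j" "j \<le> ?n - 1" for i j
      using cl[of "((i, j), (i, j + 1))"] that by (auto simp: free_box_def lattice_edges_def box_def)
    have "i \<le> ?n - 1 \<longrightarrow> collapse_outside (inner_squares n) (i, j) \<in> A"
      if "- ?n \<le> i" and j: "- ?n \<le> j" "j \<le> ?n - 1" for i j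
      using that(1)
    proof (induction i rule: int_ge_induct)
      case base
      have "collapse_outside (inner_squares n) (- ?n - 1, j) \<in> A"
        using m by (simp add: free_box_def collapse_outside_def inner_squares_def)
      then show ?case using row[of "- ?n" j] j by auto
    next
      case (step i)
      then show ?case using row[of "i + 1" j] j by auto
    qed
    then have "Some x \<in> A" if "x \<in> inner_squares n" for x
      using that by (auto simp: inner_squares_def collapse_outside_def)
    then show ?thesis using m by (auto simp: free_box_def)
  qed
qed

lemma free_box_detour:
  assumes "e \<in> edges (free_box n)"
  shows "\<exists>D\<subseteq>edges (free_box n) - {e}. card D \<le> 3 \<and>
    (\<forall>g::_ \<Rightarrow> real. \<bar>g (left_face (free_box n) e) - g (right_face (free_box n) e)\<bar>
      \<le> (\<Sum>d\<in>D. \<bar>g (left_face (free_box n) d) - g (right_face (free_box n) d)\<bar>))"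
proof -
  let ?E = "edges (free_box n)"
  have e: "e \<in> star (fst e)" using assms by (intro lattice_edge_in_star) (auto simp: free_box_def)
  \<comment> \<open>A lattice edge leaving the box has both neighbouring squares outside, and these
    collapse to the unbounded face.\<close>
  have out: "collapse_outside (inner_squares n) (left_square d) = collapse_outside (inner_squares n) (right_square d)"
    if "d \<in> star (fst e)" "d \<notin> ?E" for d
  proof -
    obtain i j where ij: "fst e = (i, j)" by fastforce
    have b: "- int n \<le> i" "i \<le> int n" "- int n \<le> j" "j \<le> int n"
      using assms ij by (auto simp: free_box_def box_def)
    have "d \<in> lattice_edges" using that(1) star_subset by blast
    then have nb: "fst d \<notin> box n \<or> snd d \<notin> box n" using that(2) by (simp add: free_box_def)
    have "d = ((i, j), (i + 1, j)) \<or> d = ((i, j), (i, j + 1)) \<or> d = ((i - 1, j), (i, j))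
        \<or> d = ((i, j - 1), (i, j))"
      using that(1) by (simp add: ij star_def)
    then show ?thesis
      using b nb by (elim disjE) (auto simp: box_def collapse_outside_def inner_squares_def)
  qed
  have lr: "left_face (free_box n) = collapse_outside (inner_squares n) \<circ> left_square"
    "right_face (free_box n) = collapse_outside (inner_squares n) \<circ> right_square"
    by (auto simp: free_box_def)
  show ?thesis
    unfolding lr o_def
    by (intro exI[of _ "(star (fst e) - {e}) \<inter> ?E"] conjI allI star_detour[OF e out] star_detour_card[OF e]) auto
qed

text \<open>Neighbouring squares of the dual grid always share an edge of the graph, so membership
  in a closed set is constant along rows and columns. The lower left square serves as a hub between
  the marked face and all others.\<close>

lemma zero_box_rooted:
  assumes "f\<^sub>0 \<in> central_faces"
  shows "rooted_face_graph (zero_box n f\<^sub>0)"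
proof
  let ?G = "zero_box n f\<^sub>0" and ?n = "int n"
  have "edges ?G \<subseteq> ({- ?n - 1..?n + 1} \<times> {- ?n - 1..?n + 1}) \<times> ({- ?n - 1..?n + 1} \<times> {- ?n - 1..?n + 1})"
    by (auto simp: zero_box_def lattice_edges_def box_def)
  then show "finite (edges ?G)" by (rule finite_subset) simp
  show "finite (faces ?G)" by (simp add: zero_box_def touching_squares_def)
  show "left_face ?G e \<in> faces ?G \<and> right_face ?G e \<in> faces ?G" if "e \<in> edges ?G" for e
    using that by (auto simp: zero_box_def lattice_edges_def box_def touching_squares_def)
  show m: "marked_face ?G \<in> faces ?G"
    using assms by (auto simp: zero_box_def central_faces_def touching_squares_def)
  show "faces ?G \<subseteq> A" if mA: "marked_face ?G \<in> A"
    and cl: "\<And>e. e \<in> edges ?G \<Longrightarrow> left_face ?G e \<in> A \<longleftrightarrow> right_face ?G e \<in> A" for A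
  proof -
    define P where "P i j \<longleftrightarrow> Some (i, j) \<in> A" for i j
    have row: "P (i - 1) j \<longleftrightarrow> P i j" if "- ?n \<le> i" "i \<le> ?n" "- ?n - 1 \<le> j" "j \<le> ?n" for i j
    proof -
      \<comment> \<open>In the bottom row j = -n-1 it is the upper endpoint that lies in the box,
        otherwise the lower one.\<close>
      have "((i, j), (i, j + 1)) \<in> edges ?G"
        using that by (cases "- ?n \<le> j") (auto simp: zero_box_def lattice_edges_def box_def)
      from cl[OF this] show ?thesis by (simp add: P_def zero_box_def)
    qed
    have col: "P i (j - 1) \<longleftrightarrow> P i j" if "- ?n \<le> j" "j \<le> ?n" "- ?n - 1 \<le> i" "i \<le> ?n" for i j
    proof -
      have "((i, j), (i + 1, j)) \<in> edges ?G"
        using that by (cases "- ?n \<le> i") (auto simp: zero_box_def lattice_edges_def box_def)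
      from cl[OF this] show ?thesis by (auto simp: P_def zero_box_def)
    qed
    have R: "i \<le> ?n \<longrightarrow> (P i j \<longleftrightarrow> P (- ?n - 1) j)" if "- ?n - 1 \<le> i" "- ?n - 1 \<le> j" "j \<le> ?n" for i j
      using that(1)
    proof (induction i rule: int_ge_induct)
      case (step i)
      then show ?case using row[of "i + 1" j] that by auto
    qed simp
    have C: "j \<le> ?n \<longrightarrow> (P i j \<longleftrightarrow> P i (- ?n - 1))" if "- ?n - 1 \<le> j" "- ?n - 1 \<le> i" "i \<le> ?n" for i j
      using that(1)
    proof (induction j rule: int_ge_induct)
      case (step j)
      then show ?case using col[of "j + 1" i] that by auto
    qed simp
    obtain a b where ab: "f\<^sub>0 = Some (a, b)" "- ?n - 1 \<le> a" "a \<le> ?n" "- ?n - 1 \<le> b" "b \<le> ?n"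
      using m by (auto simp: zero_box_def touching_squares_def)
    have "P a b" using mA ab by (simp add: zero_box_def P_def)
    then have corner: "P (- ?n - 1) (- ?n - 1)" using R[of a b] C[of b "- ?n - 1"] ab by auto
    have "P i j" if "- ?n - 1 \<le> i" "i \<le> ?n" "- ?n - 1 \<le> j" "j \<le> ?n" for i j
      using R[of i j] C[of j "- ?n - 1"] that corner by auto
    then show ?thesis by (auto simp: zero_box_def touching_squares_def P_def)
  qed
qed

lemma zero_box_detour:
  assumes "e \<in> edges (zero_box n f\<^sub>0)"
  shows "\<exists>D\<subseteq>edges (zero_box n f\<^sub>0) - {e}. card D \<le> 3 \<and>
    (\<forall>g::_ \<Rightarrow> real. \<bar>g (left_face (zero_box n f\<^sub>0) e) - g (right_face (zero_box n f\<^sub>0) e)\<bar>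
      \<le> (\<Sum>d\<in>D. \<bar>g (left_face (zero_box n f\<^sub>0) d) - g (right_face (zero_box n f\<^sub>0) d)\<bar>))"
proof -
  let ?E = "edges (zero_box n f\<^sub>0)"
  \<comment> \<open>An edge to infinity has only one endpoint in the box; the star at that endpoint
    is entirely contained in the graph.\<close>
  obtain v where v: "v = fst e \<or> v = snd e" "v \<in> box n"
  proof (cases "fst e \<in> box n")
    case False
    then have "snd e \<in> box n" using assms by (simp add: zero_box_def)
    then show ?thesis using that by blast
  qed blast
  have e: "e \<in> star v" using assms v by (intro lattice_edge_in_star) (auto simp: zero_box_def)
  have "star v \<subseteq> ?E"
    using v(2) star_subset[of v] by (cases v) (auto simp: zero_box_def star_def)
  then have out: "Some (left_square d) = Some (right_square d)" if "d \<in> star v" "d \<notin> ?E" for d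
    using that by blast
  have lr: "left_face (zero_box n f\<^sub>0) = Some \<circ> left_square"
    "right_face (zero_box n f\<^sub>0) = Some \<circ> right_square"
    by (auto simp: zero_box_def)
  show ?thesis
    unfolding lr o_def
    by (intro exI[of _ "(star v - {e}) \<inter> ?E"] conjI allI star_detour[OF e out] star_detour_card[OF e]) auto
qed

section \<open>The characteristic function of the potential difference\<close>

context rooted_face_graph
begin

lemma inv_neg_laplacian_uminus: "inv_neg_laplacian G (\<lambda>x. - u x) = (\<lambda>x. - inv_neg_laplacian G u x)"
proof (rule inv_neg_laplacian_unique)
  show "(\<lambda>x. - inv_neg_laplacian G u x) \<in> two_forms G"
    using inv_neg_laplacian_in[of u] by (simp add: two_forms_def)
  have "dvg (grad (\<lambda>x. - inv_neg_laplacian G u x)) = (\<lambda>x. - dvg (grad (inv_neg_laplacian G u)) x)"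
    using dvg_grad_linear[of "\<lambda>_. 0" "-1" "inv_neg_laplacian G u"] by (simp add: dvg_def grad_def)
  then show "dvg (grad (\<lambda>x. - inv_neg_laplacian G u x)) = to_two_form G (\<lambda>x. - u x)"
    by (simp add: dvg_grad_inv_neg_laplacian to_two_form_def fun_eq_iff)
qed

lemma coulomb_weight_uminus: "coulomb_weight b (\<lambda>x. - q x) = coulomb_weight b q"
  by (simp add: coulomb_weight_def inv_neg_laplacian_uminus form_inner_def)

end

context face_graph_with_tree
begin

text \<open>The real part comes from the estimate for 1 + cos after subtracting 1. The order on
  \<open>complex\<close> also demands a vanishing imaginary part, which follows from the symmetry of
  the law under q -> -q.\<close>

lemma coulomb_char_bound:
  fixes \<beta> :: real
  defines "b \<equiv> (2 * pi)\<^sup>2 * \<beta>"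
  assumes b: "12 \<le> b" and f: "f \<in> faces G" "f' \<in> faces G"
    and bound: "\<And>e. e \<in> E \<Longrightarrow> \<bar>grad (potential f f') e\<bar> \<le> 3 / 4"
  shows "measure_pmf.expectation (coulomb_gas G \<beta>) (\<lambda>q. exp (2 * \<i> * complex_of_real pi *
      complex_of_real (inv_laplacian G (\<lambda>x. real_of_int (q x)) f
                       - inv_laplacian G (\<lambda>x. real_of_int (q x)) f')))
    \<le> complex_of_real (exp (- exp (- (b / 2)) * form_inner G (dipole f f') (potential f f')))"
proof -
  define X where "X q = inv_laplacian G (\<lambda>x. real_of_int (q x)) f
    - inv_laplacian G (\<lambda>x. real_of_int (q x)) f'" for q
  define \<rho> where "\<rho> = exp (- exp (- (b / 2)) * form_inner G (dipole f f') (potential f f'))"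
  let ?p = "coulomb_gas G \<beta>" and ?w = "coulomb_weight b"
  let ?Q = "two_forms G :: ('f \<Rightarrow> int) set"
  define Z where "Z = infsum ?w ?Q"
  have w: "0 < ?w q" for q by (simp add: coulomb_weight_def)
  have ws: "?w summable_on ?Q" by (rule coulomb_weight_summable[OF b])
  have W: "(\<integral>\<^sup>+q. ennreal (?w q) \<partial>count_space ?Q) = ennreal Z"
    unfolding Z_def using nn_integral_count_space_infsum[OF ws] w by (simp add: less_imp_le)
  have Z: "1 \<le> Z" using coulomb_sum_ge_1[of b] unfolding W by simp
  have gas: "?p = gibbs_pmf ?Q ?w"
    unfolding coulomb_gas_def coulomb_weight_def[abs_def] b_def by simp
  have pmf: "pmf ?p q = indicator ?Q q * ?w q / Z" for q
    unfolding gas Z_def using ws w Z by (intro pmf_gibbs_pmf) (auto simp: Z_def less_imp_le)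
  \<comment> \<open>The bound 2 covers 1 + cos as well as the functions bounded by 1.\<close>
  have int: "integrable (measure_pmf ?p) h" if "\<And>q. norm (h q) \<le> 2"
    for h :: "('f \<Rightarrow> int) \<Rightarrow> 'z::{banach, second_countable_topology}"
    using that by (intro measure_pmf.integrable_const_bound[of _ 2]) auto
  have pos: "0 \<le> 1 + cos (2 * pi * X q)" for q using cos_ge_minus_one[of "2 * pi * X q"] by linarith
  have "ennreal (measure_pmf.expectation ?p (\<lambda>q. 1 + cos (2 * pi * X q))) =
      (\<integral>\<^sup>+q. ennreal (1 + cos (2 * pi * X q)) \<partial>measure_pmf ?p)"
    using pos by (intro nn_integral_eq_integral[symmetric] int) auto
  also have "\<dots> = (\<integral>\<^sup>+q. ennreal (pmf ?p q) * ennreal (1 + cos (2 * pi * X q)) \<partial>count_space UNIV)"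
    by (rule nn_integral_measure_pmf)
  also have "\<dots> = (\<integral>\<^sup>+q. ennreal (1 + cos (2 * pi * X q)) * ennreal (?w q) * ennreal (1 / Z) * indicator ?Q q
      \<partial>count_space UNIV)"
  proof (intro nn_integral_cong)
    fix q
    show "ennreal (pmf ?p q) * ennreal (1 + cos (2 * pi * X q)) =
        ennreal (1 + cos (2 * pi * X q)) * ennreal (?w q) * ennreal (1 / Z) * indicator ?Q q"
      using pos[of q] w[of q] Z
      by (cases "q \<in> ?Q") (auto simp: pmf mult.commute divide_inverse simp flip: ennreal_mult)
  qed
  also have "\<dots> = (\<integral>\<^sup>+q. ennreal (1 + cos (2 * pi * X q)) * ennreal (?w q) * ennreal (1 / Z) \<partial>count_space ?Q)"
    by (rule nn_integral_count_space_indicator[symmetric]) simp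
  also have "\<dots> = (\<integral>\<^sup>+q. ennreal (1 + cos (2 * pi * X q)) * ennreal (?w q) \<partial>count_space ?Q) * ennreal (1 / Z)"
    by (rule nn_integral_multc) simp
  also have "\<dots> \<le> ennreal (1 + \<rho>) * ennreal Z * ennreal (1 / Z)"
    unfolding \<rho>_def X_def W[symmetric]
    by (intro mult_right_mono coulomb_cos_sum_le[OF b f bound]) auto
  also have "\<dots> = ennreal (1 + \<rho>)"
    using Z by (simp add: mult.assoc \<rho>_def flip: ennreal_mult)
  finally have "measure_pmf.expectation ?p (\<lambda>q. 1 + cos (2 * pi * X q)) \<le> 1 + \<rho>"
    by (subst (asm) ennreal_le_iff) (simp_all add: \<rho>_def add_nonneg_nonneg)
  moreover have "measure_pmf.expectation ?p (\<lambda>q. 1 + cos (2 * pi * X q)) =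
      1 + measure_pmf.expectation ?p (\<lambda>q. cos (2 * pi * X q))"
  proof -
    have "\<bar>cos x\<bar> \<le> 2" for x :: real using abs_cos_le_one[of x] by linarith
    then show ?thesis by (subst Bochner_Integration.integral_add) (auto intro!: int)
  qed
  ultimately have cos: "measure_pmf.expectation ?p (\<lambda>q. cos (2 * pi * X q)) \<le> \<rho>" by simp
  define neg where "neg q = (\<lambda>x. - q x)" for q :: "'f \<Rightarrow> int"
  have neg: "inj neg" "neg (neg q) = q" for q by (auto simp: neg_def inj_def fun_eq_iff)
  have "map_pmf neg ?p = ?p"
  proof (rule pmf_eqI)
    fix q
    have "pmf (map_pmf neg ?p) q = pmf ?p (neg q)"
      using pmf_map_inj'[OF neg(1), of ?p "neg q"] by (simp add: neg(2))
    also have "\<dots> = pmf ?p q"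
      by (simp add: pmf neg_def coulomb_weight_uminus indicator_def two_forms_def)
    finally show "pmf (map_pmf neg ?p) q = pmf ?p q" .
  qed
  then have "measure_pmf.expectation ?p (\<lambda>q. sin (2 * pi * X q)) =
      measure_pmf.expectation (map_pmf neg ?p) (\<lambda>q. sin (2 * pi * X q))"
    by (simp only:)
  also have "\<dots> = measure_pmf.expectation ?p (\<lambda>q. sin (2 * pi * X (neg q)))"
    by (rule integral_map_pmf)
  finally have "measure_pmf.expectation ?p (\<lambda>q. sin (2 * pi * X q)) =
      measure_pmf.expectation ?p (\<lambda>q. sin (2 * pi * X (neg q)))" .
  moreover have "X (neg q) = - X q" for q
    by (simp add: X_def neg_def inv_laplacian_eq inv_neg_laplacian_uminus)
  ultimately have sin: "measure_pmf.expectation ?p (\<lambda>q. sin (2 * pi * X q)) = 0" by simp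
  let ?h = "\<lambda>q. exp (2 * \<i> * complex_of_real pi * complex_of_real (X q))"
  have h: "?h q = cis (2 * pi * X q)" for q by (simp add: cis_conv_exp mult_ac)
  have ih: "integrable (measure_pmf ?p) ?h" by (rule int) (simp add: h)
  have "Re (measure_pmf.expectation ?p ?h) = measure_pmf.expectation ?p (\<lambda>q. Re (?h q))"
    by (rule integral_Re[OF ih, symmetric])
  then have "Re (measure_pmf.expectation ?p ?h) \<le> \<rho>" using cos by (simp add: h)
  moreover have "Im (measure_pmf.expectation ?p ?h) = measure_pmf.expectation ?p (\<lambda>q. Im (?h q))"
    by (rule integral_Im[OF ih, symmetric])
  then have "Im (measure_pmf.expectation ?p ?h) = 0" using sin by (simp add: h)
  ultimately show ?thesis unfolding X_def \<rho>_def by (simp add: less_eq_complex_def)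
qed

end

text \<open>The spanning tree is chosen inside the proof, as the claim does not depend on it.
  Nonnegativity of the dipole energy then lets the rate exp (- b/2) be replaced by the smaller
  target rate.\<close>

lemma (in rooted_face_graph) coulomb_char_le:
  assumes \<beta>: "1 / 3 \<le> \<beta>" and f: "f \<in> faces G" "f' \<in> faces G"
    and detour: "\<And>e. e \<in> E \<Longrightarrow> \<exists>D\<subseteq>E - {e}. card D \<le> 3 \<and>
      (\<forall>g::'f \<Rightarrow> real. \<bar>g (lf e) - g (rf e)\<bar> \<le> (\<Sum>d\<in>D. \<bar>g (lf d) - g (rf d)\<bar>))"
  shows "measure_pmf.expectation (coulomb_gas G \<beta>) (\<lambda>q. exp (2 * \<i> * complex_of_real pi *
        complex_of_real (inv_laplacian G (\<lambda>x. real_of_int (q x)) f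
                         - inv_laplacian G (\<lambda>x. real_of_int (q x)) f')))
    \<le> complex_of_real (exp (- (1/2) * (M_err \<beta> / (2 * (2 * pi)\<^sup>2 * \<beta>)) *
        form_inner G (dipole f f') (potential f f')))"
proof -
  let ?b = "(2 * pi)\<^sup>2 * \<beta>" and ?R = "form_inner G (dipole f f') (potential f f')"
  obtain T \<pi> where "rooted_tree (faces G) T \<pi>" using spanning_tree by blast
  then interpret face_graph_with_tree G T \<pi> by unfold_locales
  have "\<bar>grad (potential f f') e\<bar> \<le> 3 / 4" if e: "e \<in> E" for e
  proof -
    obtain D where "D \<subseteq> E - {e}" "card D \<le> 3" "\<And>g. \<bar>grad g e\<bar> \<le> (\<Sum>d\<in>D. \<bar>grad g d\<bar>)"
      using detour[OF e] unfolding grad_def by blast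
    from grad_potential_bound[OF f e this] show ?thesis .
  qed
  note coulomb_char_bound[OF M_err_le(2)[OF \<beta>] f this]
  also have "complex_of_real (exp (- exp (- (?b / 2)) * ?R))
      \<le> complex_of_real (exp (- (1/2) * (M_err \<beta> / (2 * (2 * pi)\<^sup>2 * \<beta>)) * ?R))"
  proof -
    have "0 \<le> ?R" unfolding form_inner_inv_neg_laplacian by (simp add: sum_nonneg)
    then have "(1/2) * (M_err \<beta> / (2 * (2 * pi)\<^sup>2 * \<beta>)) * ?R \<le> (1/2) * (2 * exp (- (?b / 2))) * ?R"
      using M_err_le(1)[OF \<beta>] by (intro mult_right_mono mult_left_mono) auto
    then show ?thesis by (simp add: less_eq_complex_def)
  qed
  finally show ?thesis .
qed

theorem theorem1p2:
  shows "\<exists>K::real. \<forall>\<beta>\<ge>1/3. \<forall>n\<ge>1. \<forall>\<Lambda>\<in>boxes n. \<forall>f\<in>faces \<Lambda>. \<forall>f'\<in>faces \<Lambda>.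
    measure_pmf.expectation (coulomb_gas \<Lambda> \<beta>) (\<lambda>q. exp (2 * \<i> * complex_of_real pi *
        complex_of_real (inv_laplacian \<Lambda> (\<lambda>x. real_of_int (q x)) f
                         - inv_laplacian \<Lambda> (\<lambda>x. real_of_int (q x)) f')))
    \<le> complex_of_real (K * exp (- (1/2) * (M_err \<beta> / (2 * (2 * pi)\<^sup>2 * \<beta>)) *
        form_inner \<Lambda> (\<lambda>x. indicator {f} x - indicator {f'} x)
          (inv_neg_laplacian \<Lambda> (\<lambda>x. indicator {f} x - indicator {f'} x))))"
proof (intro exI[of _ 1] allI impI ballI)
  fix \<beta> :: real and n :: nat and \<Lambda> :: lattice_graph and f f'
  assume \<beta>: "1 / 3 \<le> \<beta>" and \<Lambda>: "\<Lambda> \<in> boxes n" and f: "f \<in> faces \<Lambda>" "f' \<in> faces \<Lambda>"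
  have rooted: "rooted_face_graph \<Lambda>"
    using \<Lambda> free_box_rooted zero_box_rooted by (auto simp: boxes_def)
  have detour: "\<exists>D\<subseteq>edges \<Lambda> - {e}. card D \<le> 3 \<and> (\<forall>g::_ \<Rightarrow> real.
      \<bar>g (left_face \<Lambda> e) - g (right_face \<Lambda> e)\<bar> \<le> (\<Sum>d\<in>D. \<bar>g (left_face \<Lambda> d) - g (right_face \<Lambda> d)\<bar>))"
    if e: "e \<in> edges \<Lambda>" for e
  proof -
    consider "\<Lambda> = free_box n" | f\<^sub>0 where "\<Lambda> = zero_box n f\<^sub>0"
      using \<Lambda> unfolding boxes_def by blast
    then show ?thesis
    proof cases
      case 1
      show ?thesis using free_box_detour[of e n] e unfolding 1 .
    next
      case 2
      show ?thesis using zero_box_detour[of e n f\<^sub>0] e unfolding 2 .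
    qed
  qed
  show "measure_pmf.expectation (coulomb_gas \<Lambda> \<beta>) (\<lambda>q. exp (2 * \<i> * complex_of_real pi *
        complex_of_real (inv_laplacian \<Lambda> (\<lambda>x. real_of_int (q x)) f
                         - inv_laplacian \<Lambda> (\<lambda>x. real_of_int (q x)) f')))
    \<le> complex_of_real (1 * exp (- (1/2) * (M_err \<beta> / (2 * (2 * pi)\<^sup>2 * \<beta>)) *
        form_inner \<Lambda> (\<lambda>x. indicator {f} x - indicator {f'} x)
          (inv_neg_laplacian \<Lambda> (\<lambda>x. indicator {f} x - indicator {f'} x))))"
    using rooted_face_graph.coulomb_char_le[OF rooted \<beta> f detour]
    by (simp only: rooted_face_graph.dipole_def[OF rooted] mult_1)
qed

end
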